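(* Let $p_1, p_2,\ldots , p_t$ be distinct primes. Then (a) $K(p_1, p_2,\ldots , p_t)$ is a union of finitely many arithmetic progressions; (b) there exist two constants $k_0=k_0(p_1, p_2,\ldots , p_t)$ and $c_1=c_1(p_1, p_2,\ldots , p_t)>1$ such that for all $k>k_0$ with $k\in K(p_1, p_2,\ldots , p_t)$ we have $$c_1^k\le T_{k}(p_1, p_2,\ldots , p_t)\le (\sqrt 2)^{tk^2(1+o_k(1))}.$$
   Context: Let $\mathbb{N}_0$ be the set of nonnegative integers. For distinct primes $p_1,\ldots,p_t$, let $S(p_1,\ldots , p_t)=\{ p_1^{\alpha_1}\cdots p_t^{\alpha_t}\mid \alpha_i\in \mathbb{N}_0,\ i=1,\ldots , t \}$. For a positive integer $k$, $T_k(p_1,\ldots , p_t)$ is the number of solutions of $\sum_{i=1}^{k}\frac 1{x_i}=1$ with $1<x_1<x_2<\cdots <x_{k}$ and $x_i\in S(p_1,\ldots , p_t)$ for $1\le i\le k$. Define $K(p_1,\ldots , p_t)=\{ k\ge 1 : T_{k} (p_1,\ldots ,p_t)\ge 1\}$. An arithmetic progression here is an infinite one, i.e. a set $\{a+dn : n\in\mathbb{N}_0\}$ with integers $a$ and $d\ge 1$; the empty set counts as the union of zero progressions. The notation $o_k(1)$ stands for a quantity (which may depend on $p_1,\ldots,p_t$) tending to $0$ as $k\to\infty$. *)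

theory Defs
  imports Complex_Main "HOL-Computational_Algebra.Primes"
begin

text \<open>The primes are given as \<open>p 1, \<dots>, p t\<close>; values of \<open>p\<close> outside \<open>{1..t}\<close> are irrelevant.\<close>

definition S :: "nat \<Rightarrow> (nat \<Rightarrow> nat) \<Rightarrow> nat set" where
  "S t p = {\<Prod>i=1..t. p i ^ \<alpha> i | \<alpha> :: nat \<Rightarrow> nat. True}"

definition solutions :: "nat \<Rightarrow> (nat \<Rightarrow> nat) \<Rightarrow> nat \<Rightarrow> nat list set" where
  "solutions t p k =
     {xs. length xs = k \<and> sorted_wrt (<) xs \<and> (\<forall>x\<in>set xs. 1 < x \<and> x \<in> S t p) \<and>
          (\<Sum>x\<leftarrow>xs. 1 / real x) = 1}"

definition T :: "nat \<Rightarrow> (nat \<Rightarrow> nat) \<Rightarrow> nat \<Rightarrow> nat" where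
  "T t p k = card (solutions t p k)"

definition K :: "nat \<Rightarrow> (nat \<Rightarrow> nat) \<Rightarrow> nat set" where
  "K t p = {k. 1 \<le> k \<and> 1 \<le> T t p k}"

definition arith_prog :: "int set \<Rightarrow> bool" where
  "arith_prog A \<longleftrightarrow> (\<exists>a d. 1 \<le> d \<and> A = {a + d * int n | n. True})"

text \<open>
  The cardinality of an infinite set is \<open>0\<close> in HOL. The following shows that the definition
  of \<open>T\<close> is never affected by this convention.
\<close>

lemma finite_reciprocal_sums:
  "finite {xs :: nat list. length xs = k \<and> sorted_wrt (<) xs \<and> (\<forall>x\<in>set xs. 1 < x) \<and>
             (\<Sum>x\<leftarrow>xs. 1 / real x) = r}"
proof (induction k arbitrary: r)
  case 0
  then show ?case
    by (rule finite_subset[of _ "{[]}"]) auto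
next
  case (Suc k)
  let ?A = "\<lambda>k r. {xs :: nat list. length xs = k \<and> sorted_wrt (<) xs \<and> (\<forall>x\<in>set xs. 1 < x) \<and>
             (\<Sum>x\<leftarrow>xs. 1 / real x) = r}"
  have "?A (Suc k) r \<subseteq> (\<Union>y\<in>{..nat \<lceil>real (Suc k) / r\<rceil>}. (#) y ` ?A k (r - 1 / real y))"
  proof
    fix xs assume xs: "xs \<in> ?A (Suc k) r"
    then obtain y ys where [simp]: "xs = y # ys"
      by (auto simp: length_Suc_conv)
    have y: "1 < y" "\<forall>x\<in>set ys. y < x" and len: "length ys = k"
      and sum: "1 / real y + (\<Sum>x\<leftarrow>ys. 1 / real x) = r"
      using xs by auto
    have "(\<Sum>x\<leftarrow>ys. 1 / real x) \<le> (\<Sum>x\<leftarrow>ys. 1 / real y)"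
      using y by (intro sum_list_mono) (auto simp: field_simps)
    then have upper: "r \<le> real (Suc k) / real y"
      using sum len by (simp add: sum_list_triv add_divide_distrib)
    have "0 \<le> (\<Sum>x\<leftarrow>ys. 1 / real x)"
      by (rule sum_list_nonneg) auto
    moreover have "0 < 1 / real y" using y by simp
    ultimately have "0 < r"
      using sum by linarith
    with upper have "real y \<le> real (Suc k) / r"
      using y by (simp add: field_simps)
    then have "y \<le> nat \<lceil>real (Suc k) / r\<rceil>"
      by linarith
    moreover have "ys \<in> ?A k (r - 1 / real y)"
      using xs by auto
    ultimately show "xs \<in> (\<Union>y\<in>{..nat \<lceil>real (Suc k) / r\<rceil>}. (#) y ` ?A k (r - 1 / real y))"
      by auto
  qed
  moreover have "finite (\<Union>y\<in>{..nat \<lceil>real (Suc k) / r\<rceil>}. (#) y ` ?A k (r - 1 / real y))"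
    using Suc.IH by auto
  ultimately show ?case
    by (rule finite_subset)
qed

lemma finite_solutions: "finite (solutions t p k)"
  by (rule finite_subset[OF _ finite_reciprocal_sums[of k 1]]) (auto simp: solutions_def)

end

theory Submission
  imports Defs "HOL-Number_Theory.Residues"
begin

text \<open>
  A solution is treated as the set \<open>D\<close> of its unit fractions. If \<open>\<mu>\<close> is the least element of \<open>D\<close>, then
  replacing \<open>\<mu>\<close> by \<open>\<mu> E\<close>, for another solution \<open>E\<close>, gives a solution with \<open>card D + card E - 1\<close> elements
  that determines \<open>D\<close> and \<open>E\<close>. Hence \<open>T\<^sub>k T\<^sub>m \<le> T\<^bsub>k+m-1\<^esub>\<close>, which gives (a), and also the lower bound in (b)
  once some \<open>m\<close> has \<open>T\<^sub>m \<ge> 2\<close>.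

  To find such an \<open>m\<close>, start with any solution \<open>D\<close>. If \<open>D\<close> has an element \<open>m \<noteq> \<mu>\<close> for which \<open>m D\<close> and
  \<open>D\<close> are disjoint, expanding \<open>m\<close> or \<open>\<mu>\<close> by \<open>D\<close> gives two solutions. Otherwise all denominators of \<open>D\<close>
  divide \<open>N = 1/\<mu>\<close>, and \<open>N\<close> has two distinct prime factors \<open>p\<close>, \<open>q\<close>. A variant of Birch's theorem
  on sums of distinct \<open>p\<^sup>a q\<^sup>b\<close> writes \<open>1\<close> as a sum of a set \<open>E\<close> of numbers \<open>p\<^sup>a q\<^sup>b < 1\<close>
  with \<open>a, b \<in> \<int>\<close> that omits the largest element of \<open>D\<close>. The expansions of \<open>D\<close> by \<open>E\<close> and of \<open>E\<close> by \<open>D\<close>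
  then differ but have the same size; inserting both at the end of the \<open>n\<close>-fold expansion of \<open>D\<close>
  scales them by \<open>N\<^sup>-\<^sup>n\<close> and clears all denominators.

  For the upper bound, \<open>1 - 1/x\<^sub>1 - \<dots> - 1/x\<^bsub>i-1\<^esub>\<close> is a positive multiple of \<open>1/(x\<^sub>1 \<dots> x\<^bsub>i-1\<^esub>)\<close>, so
  \<open>x\<^sub>i \<le> k x\<^sub>1 \<dots> x\<^bsub>i-1\<^esub>\<close> and \<open>x\<^sub>i\<close> is at most \<open>k\<close> to the power \<open>2\<^sup>i\<^sup>-\<^sup>1\<close>;
  this leaves at most \<open>(k 2\<^sup>i)\<^sup>t\<close> values in \<open>S\<close> for \<open>x\<^sub>i\<close>.
\<close>

section \<open>Sums of distinct numbers of the form \<open>p\<^sup>a q\<^sup>b\<close>\<close>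

text \<open>Greedy choice from the top: if \<open>n\<close> exceeds \<open>L\<close> plus the sum of
  all elements below \<open>X\<close>, then \<open>X\<close> must lie in \<open>F\<close>, the gap
  hypothesis gives \<open>X \<le> n\<close>, and it remains to treat \<open>n - X\<close>.\<close>

lemma subset_sums_bounded_gaps:
  fixes F :: "nat set"
  assumes gap: "\<And>f. f \<in> F \<Longrightarrow> f \<le> L + \<Sum>{g \<in> F. g < f}"
  shows "n \<le> L + \<Sum>{g \<in> F. g < X} \<Longrightarrow>
    \<exists>U\<subseteq>{g \<in> F. g < X}. \<Sum>U \<le> n \<and> n \<le> \<Sum>U + L"
proof (induction X arbitrary: n)
  case 0
  then show ?case by (intro exI[of _ "{}"]) auto
next
  case (Suc X)
  show ?case
  proof (cases "n \<le> L + \<Sum>{g \<in> F. g < X}")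
    case True
    from Suc.IH[OF this] obtain U where "U \<subseteq> {g \<in> F. g < X}" "\<Sum>U \<le> n" "n \<le> \<Sum>U + L"
      by blast
    then show ?thesis by (intro exI[of _ U]) auto
  next
    case False
    have "X \<in> F"
    proof (rule ccontr)
      assume "X \<notin> F"
      then have "{g \<in> F. g < Suc X} = {g \<in> F. g < X}"
        by (auto simp: less_Suc_eq)
      with Suc.prems False show False by simp
    qed
    then have eq: "{g \<in> F. g < Suc X} = insert X {g \<in> F. g < X}"
      by (auto simp: less_Suc_eq)
    have "n - X \<le> L + \<Sum>{g \<in> F. g < X}"
      using Suc.prems unfolding eq by simp
    from Suc.IH[OF this] obtain U
      where U: "U \<subseteq> {g \<in> F. g < X}" "\<Sum>U \<le> n - X" "n - X \<le> \<Sum>U + L"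
      by blast
    have "X \<le> n"
      using gap[OF \<open>X \<in> F\<close>] False by simp
    moreover have "\<Sum>(insert X U) = X + \<Sum>U"
      using U(1) finite_subset[OF U(1)] by (subst sum.insert) auto
    ultimately show ?thesis
      using U by (intro exI[of _ "insert X U"]) (auto simp: eq)
  qed
qed

text \<open>By Euler's theorem \<open>g ^ b\<close> is 1 modulo \<open>m\<close> whenever
  \<open>totient m\<close> divides \<open>b\<close>, so \<open>u\<close> such powers sum to
  \<open>u\<close>. The lower bound \<open>N\<close> moves the exponents out of a given finite
  set.\<close>

lemma sum_powers_cong:
  fixes g m :: nat
  assumes "coprime g m" "m > 0"
  shows "\<exists>B. finite B \<and> (\<forall>b\<in>B. N \<le> b) \<and> [(\<Sum>b\<in>B. g ^ b) = u] (mod m)"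
proof -
  have tot: "totient m > 0" using assms by simp
  have inj: "inj_on (\<lambda>i. totient m * i) {N..<N + u}"
    using tot by (auto intro: inj_onI)
  have "[(\<Sum>i\<in>{N..<N + u}. (g ^ totient m) ^ i) = (\<Sum>i\<in>{N..<N + u}. 1 ^ i)] (mod m)"
    by (intro cong_sum cong_pow euler_theorem assms)
  then have "[(\<Sum>b\<in>(\<lambda>i. totient m * i) ` {N..<N + u}. g ^ b) = u] (mod m)"
    using inj by (simp add: sum.reindex power_mult)
  moreover have "N \<le> totient m * i" if "N \<le> i" for i
    using that tot by (metis One_nat_def Suc_leI mult_le_mono nat_mult_1)
  ultimately show ?thesis
    by (intro exI[of _ "(\<lambda>i. totient m * i) ` {N..<N + u}"]) auto
qed

lemma bounded_coordinates:
  fixes X :: "(int \<times> int) set"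
  assumes "finite X"
  obtains R :: nat where "R > N" "\<And>a b. (a, b) \<in> X \<Longrightarrow> \<bar>a\<bar> < int R \<and> \<bar>b\<bar> < int R"
proof -
  have "finite ((\<lambda>z. nat \<bar>fst z\<bar> + nat \<bar>snd z\<bar>) ` X)" using assms by simp
  then obtain R where R: "\<And>z. z \<in> X \<Longrightarrow> nat \<bar>fst z\<bar> + nat \<bar>snd z\<bar> < R"
    by (auto simp: finite_nat_set_iff_bounded)
  show thesis
  proof (rule that[of "R + Suc N"])
    fix a b assume "(a, b) \<in> X"
    from R[OF this] show "\<bar>a\<bar> < int (R + Suc N) \<and> \<bar>b\<bar> < int (R + Suc N)" by auto
  qed simp
qed

context
  fixes p q :: nat
  assumes p: "prime p" and q: "prime q" and pq: "p \<noteq> q"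
begin

lemma pq_gt_1: "p > 1" "q > 1"
  using p q prime_gt_1_nat by auto

lemma coprime_pq: "coprime p q"
  using p q pq by (rule primes_coprime)

text \<open>
  For each of the \<open>p\<close> exponents \<open>b\<close>, the largest \<open>p\<^sup>a q\<^sup>b\<close> below \<open>f\<close> is at least \<open>f / p\<close>; so the
  elements below \<open>f\<close> have sum at least \<open>f\<close>.
\<close>

lemma band_subset_sums_bounded_gaps:
  "\<exists>U. finite U \<and> U \<subseteq> {p ^ a * q ^ b | a b. 1 \<le> b \<and> b \<le> p} \<and> \<Sum>U \<le> n \<and> n \<le> \<Sum>U + q ^ p"
proof -
  define F where "F = {p ^ a * q ^ b | a b. 1 \<le> b \<and> b \<le> p}"
  have gap: "f \<le> q ^ p + \<Sum>{g \<in> F. g < f}" if "f \<in> F" for f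
  proof (cases "f \<le> q ^ p")
    case False
    have "\<exists>a. p ^ a * q ^ b < f \<and> f \<le> p * (p ^ a * q ^ b)" if b: "b \<in> {1..p}" for b
    proof -
      \<comment> \<open>Since \<open>f\<close> exceeds \<open>q ^ p\<close>, the exponent 0 is
        admissible for every \<open>b \<le> p\<close>, so a largest admissible one exists.\<close>
      define A where "A = {a. p ^ a * q ^ b < f}"
      have "q ^ b \<le> q ^ p"
        using b pq_gt_1 by (intro power_increasing) auto
      then have "0 \<in> A" using False by (simp add: A_def)
      moreover have "finite A"
      proof (rule finite_subset)
        show "A \<subseteq> {..f}"
        proof
          fix a assume "a \<in> A"
          have "a \<le> p ^ a" using power_gt_expt[of p a] pq_gt_1 by simp
          also have "\<dots> \<le> p ^ a * q ^ b" using pq_gt_1 by simp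
          finally show "a \<in> {..f}" using \<open>a \<in> A\<close> by (simp add: A_def)
        qed
      qed simp
      ultimately obtain a where "a \<in> A" "Suc a \<notin> A"
        by (metis Max_in empty_iff Max_ge Suc_n_not_le_n)
      then show ?thesis
        unfolding A_def by (intro exI[of _ a]) (simp add: mult.assoc)
    qed
    then obtain a where a: "\<And>b. b \<in> {1..p} \<Longrightarrow> p ^ a b * q ^ b < f \<and> f \<le> p * (p ^ a b * q ^ b)"
      by metis
    define g where "g b = p ^ a b * q ^ b" for b
    have inj: "inj_on g {1..p}"
    proof (rule inj_onI)
      fix b c assume "g b = g c"
      moreover have "multiplicity q (g b) = b" for b
      proof -
        have "multiplicity q (p ^ a b) = 0"
          using p q pq by (metis multiplicity_distinct_prime_power)
        then show ?thesis
          unfolding g_def using p q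
          by (subst prime_elem_multiplicity_mult_distrib) auto
      qed
      ultimately show "b = c" by metis
    qed
    have "p * f = (\<Sum>b\<in>{1..p}. f)" by simp
    also have "\<dots> \<le> (\<Sum>b\<in>{1..p}. p * g b)"
      using a by (intro sum_mono) (auto simp: g_def)
    also have "\<dots> = p * \<Sum>(g ` {1..p})"
      using inj by (simp add: sum.reindex sum_distrib_left)
    finally have "f \<le> \<Sum>(g ` {1..p})"
      using pq_gt_1 by simp
    also have "\<dots> \<le> \<Sum>{g \<in> F. g < f}"
    proof (rule sum_mono2)
      show "g ` {1..p} \<subseteq> {g \<in> F. g < f}"
      proof
        fix x assume "x \<in> g ` {1..p}"
        then obtain b where b: "x = g b" "b \<in> {1..p}" by blast
        then have "x < f" using a by (simp add: g_def)
        moreover have "x \<in> F"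
          using b unfolding F_def g_def by (intro CollectI exI[of _ "a b"] exI[of _ b]) auto
        ultimately show "x \<in> {g \<in> F. g < f}" by simp
      qed
    qed auto
    finally show ?thesis by simp
  qed simp
  \<comment> \<open>This element is at least \<open>n\<close>, so cutting \<open>F\<close> off just
    above it leaves a total large enough for the target \<open>n\<close>.\<close>
  have "p ^ n * q ^ 1 \<in> F"
    unfolding F_def using pq_gt_1 by (intro CollectI exI[of _ n] exI[of _ 1]) auto
  moreover have "n \<le> p ^ n * q ^ 1"
  proof -
    have "n \<le> p ^ n" using power_gt_expt[of p n] pq_gt_1 by simp
    also have "\<dots> \<le> p ^ n * q ^ 1" using pq_gt_1 by simp
    finally show ?thesis .
  qed
  moreover have "f \<le> \<Sum>{g \<in> F. g < Suc f}" if "f \<in> F" for f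
    using that member_le_sum[of f "{g \<in> F. g < Suc f}" "\<lambda>x. x"] by simp
  ultimately have "n \<le> \<Sum>{g \<in> F. g < Suc (p ^ n * q ^ 1)}"
    using order_trans by blast
  then have "n \<le> q ^ p + \<Sum>{g \<in> F. g < Suc (p ^ n * q ^ 1)}"
    by (rule trans_le_add2)
  from subset_sums_bounded_gaps[of F, OF gap this] obtain U
    where U: "U \<subseteq> {g \<in> F. g < Suc (p ^ n * q ^ 1)}" "\<Sum>U \<le> n" "n \<le> \<Sum>U + q ^ p"
    by blast
  then have "finite U" using finite_subset[OF U(1)] by simp
  with U show ?thesis unfolding F_def by blast
qed

section \<open>Exponent vectors and their values\<close>

text \<open>Sets of exponent vectors stand for sets of distinct numbers: \<open>val\<close> turns
  differences into quotients and is injective, so disjointness can be checked on exponents.\<close>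

definition val :: "int \<times> int \<Rightarrow> real" where
  "val z = real p powi fst z * real q powi snd z"

lemma val_pos: "val z > 0"
  using pq_gt_1 by (simp add: val_def)

lemma val_diff: "val (a - c, b - d) = val (a, b) / val (c, d)"
  using pq_gt_1 by (simp add: val_def power_int_diff)

lemma val_nat: "val (int a, int b) = real (p ^ a * q ^ b)"
  by (simp add: val_def)

lemma power_eq_power_imp: "p ^ a = q ^ b \<Longrightarrow> a = 0 \<and> b = 0"
  using p q pq pq_gt_1 by (metis nat_power_eq_Suc_0_iff power_0 prime_dvd_power primes_dvd_imp_eq
    dvd_power gr0I less_numeral_extra(4) One_nat_def)

text \<open>Unique factorization, after powers with negative exponent are moved to the other side;
  the four cases are the sign patterns.\<close>

lemma val_eq_1_iff: "val z = 1 \<longleftrightarrow> z = (0, 0)"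
proof
  assume 1: "val z = 1"
  obtain a b where z: "z = (a, b)" by (cases z)
  have rp: "real p > 0" "real q > 0" using pq_gt_1 by auto
  consider m n where "a = int m" "b = int n" | m n where "a = - int m" "b = - int n"
    | m n where "a = - int m" "b = int n" | m n where "a = int m" "b = - int n"
    using int_cases2 by metis
  then show "z = (0, 0)"
  proof cases
    case 1
    with \<open>val z = 1\<close> z have "p ^ m * q ^ n = 1" by (metis val_nat of_nat_eq_1_iff)
    then show ?thesis using 1 z pq_gt_1 by auto
  next
    case 2
    with \<open>val z = 1\<close> z rp have "real (p ^ m * q ^ n) = 1" by (simp add: val_def power_int_minus field_simps)
    then have "p ^ m * q ^ n = 1" by (metis of_nat_eq_1_iff)
    then show ?thesis using 2 z pq_gt_1 by auto
  next
    case 3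
    with \<open>val z = 1\<close> z rp have "real (p ^ m) = real (q ^ n)" by (simp add: val_def power_int_minus field_simps)
    then have "p ^ m = q ^ n" by (metis of_nat_eq_iff)
    then show ?thesis using 3 z power_eq_power_imp by auto
  next
    case 4
    with \<open>val z = 1\<close> z rp have "real (p ^ m) = real (q ^ n)" by (simp add: val_def power_int_minus field_simps)
    then have "p ^ m = q ^ n" by (metis of_nat_eq_iff)
    then show ?thesis using 4 z power_eq_power_imp by auto
  qed
qed (simp add: val_def)

lemma val_eq_iff: "val y = val z \<longleftrightarrow> y = z"
proof
  assume "val y = val z"
  then have "val (fst y - fst z, snd y - snd z) = 1"
    using val_pos[of z] by (simp add: val_diff)
  then show "y = z" by (simp add: val_eq_1_iff prod_eq_iff)
qed simp


text \<open>
  The exponents of the numbers used to fill up bounded gaps. The finitely many other numbers, which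
  provide the fine adjustment, are chosen with exponents outside this strip.
\<close>

abbreviation strip :: "(int \<times> int) set" where
  "strip \<equiv> {(a, b). 1 \<le> b \<and> b \<le> int p}"

text \<open>Pigeonhole: an \<open>n\<close> by \<open>n\<close> grid of exponents has
  \<open>2 ^ (n * n)\<close> subsets, but their sums are at most
  \<open>n\<^sup>2 * k ^ n\<close>.\<close>

lemma distinct_subsets_equal_sum:
  assumes "P > (1 :: nat)" "Q > 1"
  obtains A B :: "(nat \<times> nat) set" where "finite A" "finite B" "A \<noteq> B"
    "(\<Sum>(i, j)\<in>A. P ^ i * Q ^ j) = (\<Sum>(i, j)\<in>B. P ^ i * Q ^ j)"
proof -
  define k where "k = P * Q"
  \<comment> \<open>Then \<open>n * n = k * n + 4 * n\<close> exceeds the exponent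
    \<open>1 + n * 2 + k * n\<close> reached below.\<close>
  define n where "n = k + 4"
  define I where "I = {..<n} \<times> {..<n}"
  define f where "f A = (\<Sum>(i, j)\<in>A. P ^ i * Q ^ j)" for A
  have f_le: "f A \<le> n\<^sup>2 * k ^ n" if "A \<subseteq> I" for A
  proof -
    have "f A \<le> f I"
      unfolding f_def using that by (intro sum_mono2) (auto simp: I_def)
    also have "\<dots> \<le> (\<Sum>z\<in>I. k ^ n)"
      unfolding f_def k_def power_mult_distrib using assms
      by (intro sum_mono) (auto simp: I_def intro!: mult_le_mono power_increasing)
    also have "\<dots> = n\<^sup>2 * k ^ n" by (simp add: I_def power2_eq_square)
    finally show ?thesis .
  qed
  have "card (f ` Pow I) \<le> card {..n\<^sup>2 * k ^ n}"
    using f_le by (intro card_mono) auto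
  also have "\<dots> \<le> 2 * (n\<^sup>2 * k ^ n)"
    using assms by (simp add: n_def k_def)
  also have "\<dots> \<le> 2 * ((2 ^ n)\<^sup>2 * (2 ^ k) ^ n)"
    using less_exp[of n] less_exp[of k] by (intro mult_le_mono power_mono) auto
  also have "\<dots> = 2 ^ (1 + n * 2 + k * n)"
    by (simp add: power_add power_mult)
  also have "\<dots> < 2 ^ (n * n)"
    by (intro power_strict_increasing) (auto simp: n_def algebra_simps)
  also have "\<dots> = card (Pow I)"
    by (simp add: I_def card_Pow)
  finally have "\<not> inj_on f (Pow I)"
    by (rule pigeonhole)
  then obtain A B where "A \<subseteq> I" "B \<subseteq> I" "A \<noteq> B" "f A = f B"
    by (auto simp: inj_on_def)
  moreover have "finite I" by (simp add: I_def)
  ultimately show thesis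
    using that[of A B] unfolding f_def by (meson finite_subset)
qed

text \<open>
  Divide a coincidence of subset sums of \<open>p\<^sup>R\<^sup>i q\<^sup>R\<^sup>j\<close> by a term that occurs on one side only. The remaining
  exponents are nonzero vectors of \<open>R \<int>\<^sup>2\<close>; for large \<open>R\<close> these avoid \<open>X\<close> and the strip.
\<close>

lemma sums_differ_by_one:
  assumes "finite X"
  shows "\<exists>U V. finite U \<and> finite V \<and> (U \<union> V) \<inter> (X \<union> strip) = {} \<and> sum val U = sum val V + 1"
proof -
  obtain R where R: "R > p" "\<And>a b. (a, b) \<in> X \<Longrightarrow> \<bar>a\<bar> < int R \<and> \<bar>b\<bar> < int R"
    using bounded_coordinates[OF assms, of p] by blast
  have R0: "R > 0" using R(1) by simp
  define w where "w z = (p ^ R) ^ fst z * (q ^ R) ^ snd z" for z :: "nat \<times> nat"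
  have "p ^ R > 1" "q ^ R > 1"
    using pq_gt_1 R0 one_less_power by blast+
  from distinct_subsets_equal_sum[OF this]
  obtain A0 B0 where AB0: "finite A0" "finite B0" "A0 \<noteq> B0" "sum w A0 = sum w B0"
    unfolding w_def by (auto simp: case_prod_beta)
  obtain A B a where AB: "finite A" "finite B" "sum w A = sum w B" "a \<in> A" "a \<notin> B"
  proof (cases "A0 \<subseteq> B0")
    case True
    then obtain a where "a \<in> B0" "a \<notin> A0" using AB0 by blast
    then show ?thesis using that[of B0 A0 a] AB0 by simp
  next
    case False
    then obtain a where "a \<in> A0" "a \<notin> B0" by blast
    then show ?thesis using that[of A0 B0 a] AB0 by simp
  qed
  \<comment> \<open>The exponent vector of \<open>w z / w a\<close>; the term \<open>a\<close>
    itself becomes the zero vector, whose value is the difference 1.\<close>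
  define g where "g z = (int R * (int (fst z) - int (fst a)), int R * (int (snd z) - int (snd a)))"
    for z :: "nat \<times> nat"
  have inj: "inj_on g C" for C
    using R0 by (auto simp: inj_on_def g_def prod_eq_iff)
  have wa: "w a > 0" using pq_gt_1 by (simp add: w_def)
  have val_g: "val (g z) = real (w z) / real (w a)" for z
  proof -
    have "g z = (int (R * fst z) - int (R * fst a), int (R * snd z) - int (R * snd a))"
      by (simp add: g_def right_diff_distrib)
    then show ?thesis
      by (simp only: val_diff val_nat w_def power_mult)
  qed
  have sum_g: "sum val (g ` C) = real (sum w C) / real (w a)" for C
    by (simp add: sum.reindex[OF inj] val_g sum_divide_distrib)
  have "sum w A = w a + sum w (A - {a})"
    using AB by (simp add: sum.remove)
  then have sum: "sum val (g ` B) = sum val (g ` (A - {a})) + 1"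
    using wa AB(3) by (simp add: sum_g field_simps)
  have avoid: "g z \<notin> X \<union> strip" if "z \<noteq> a" for z
  proof
    define c d where "c = int (fst z) - int (fst a)" and "d = int (snd z) - int (snd a)"
    have g: "g z = (int R * c, int R * d)" by (simp add: g_def c_def d_def)
    have small: "e = 0" if "\<bar>int R * e\<bar> < int R" for e
    proof (rule ccontr)
      assume "e \<noteq> 0"
      then have "int R * 1 \<le> int R * \<bar>e\<bar>" by (intro mult_left_mono) auto
      with that show False by (simp add: abs_mult)
    qed
    assume "g z \<in> X \<union> strip"
    then show False
    proof
      assume "g z \<in> X"
      with R(2) small have "c = 0 \<and> d = 0" by (simp add: g)
      with that show False by (simp add: c_def d_def prod_eq_iff)
    next
      assume *: "g z \<in> strip"
      then have "1 \<le> int R * d" "int R * d \<le> int p" by (simp_all add: g)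
      then have "\<bar>int R * d\<bar> < int R" using R(1) by linarith
      then have "d = 0" by (rule small)
      with * show False by (simp add: g)
    qed
  qed
  have "(g ` B \<union> g ` (A - {a})) \<inter> (X \<union> strip) = {}"
  proof (rule Int_emptyI)
    fix y assume "y \<in> g ` B \<union> g ` (A - {a})"
    then obtain z where "y = g z" "z \<noteq> a" using AB(5) by blast
    moreover assume "y \<in> X \<union> strip"
    ultimately show False using avoid[of z] by (simp only: not_False_eq_True)
  qed
  with sum show ?thesis
    using AB(1,2) by (intro exI[of _ "g ` B"] exI[of _ "g ` (A - {a})"]) simp
qed

text \<open>A fresh pair with \<open>sum val U = sum val V + 1\<close> lengthens the run: joining
  \<open>V\<close> to the old subsets shifts all their sums by \<open>sum val V\<close>, and joining
  \<open>U\<close> to the last one gives one value more.\<close>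

lemma consecutive_sums:
  "\<exists>X c. finite X \<and> X \<inter> strip = {} \<and> (\<forall>j\<le>L. \<exists>U\<subseteq>X. sum val U = c + real j)"
proof (induction L)
  case 0
  show ?case by (intro exI[of _ "{}"] exI[of _ 0]) auto
next
  case (Suc L)
  then obtain X c where X: "finite X" "X \<inter> strip = {}"
    and sums: "\<And>j. j \<le> L \<Longrightarrow> \<exists>U\<subseteq>X. sum val U = c + real j" by blast
  from sums_differ_by_one[OF X(1)] obtain U V where UV: "finite U" "finite V"
    "(U \<union> V) \<inter> (X \<union> strip) = {}" "sum val U = sum val V + 1" by blast
  have "\<exists>W\<subseteq>X \<union> U \<union> V. sum val W = (c + sum val V) + real j" if "j \<le> Suc L" for j
  proof (cases "j = Suc L")
    case True
    obtain W where W: "W \<subseteq> X" "sum val W = c + real L" using sums[of L] by blast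
    have "sum val (W \<union> U) = sum val W + sum val U"
      using W UV X(1) finite_subset[of W X] by (intro sum.union_disjoint) blast+
    then show ?thesis using W UV True by (intro exI[of _ "W \<union> U"]) auto
  next
    case False
    obtain W where W: "W \<subseteq> X" "sum val W = c + real j" using sums[of j] False \<open>j \<le> Suc L\<close> by (metis le_SucE)
    have "sum val (W \<union> V) = sum val W + sum val V"
      using W UV X(1) finite_subset[of W X] by (intro sum.union_disjoint) blast+
    then show ?thesis using W UV by (intro exI[of _ "W \<union> V"]) auto
  qed
  then show ?case using X UV by (intro exI[of _ "X \<union> U \<union> V"] exI[of _ "c + sum val V"]) auto
qed

lemma sum_val_common_denominator:
  assumes "finite U"
  obtains u e where "e > 0" "sum val U = real u / real (p ^ e * q ^ e)"
proof -
  obtain e where e: "e > 0" "\<And>a b. (a, b) \<in> U \<Longrightarrow> \<bar>a\<bar> < int e \<and> \<bar>b\<bar> < int e"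
    using bounded_coordinates[OF assms, of 0] by blast
  define w where "w z = p ^ nat (fst z + int e) * q ^ nat (snd z + int e)" for z
  have "val z = real (w z) / real (p ^ e * q ^ e)" if "z \<in> U" for z
  proof -
    have "\<bar>fst z\<bar> < int e" "\<bar>snd z\<bar> < int e" using e(2)[of "fst z" "snd z"] that by auto
    then have "z = (int (nat (fst z + int e)) - int e, int (nat (snd z + int e)) - int e)"
      by (auto simp: prod_eq_iff)
    then have "val z = val (int (nat (fst z + int e)) - int e, int (nat (snd z + int e)) - int e)"
      by simp
    then show ?thesis by (simp only: val_diff val_nat w_def)
  qed
  then have "sum val U = real (sum w U) / real (p ^ e * q ^ e)"
    by (simp add: sum_divide_distrib)
  with e(1) show thesis by (rule that)
qed

text \<open>
  By Euler's theorem, sums of distinct \<open>q\<^sup>b\<close> hit every residue modulo \<open>p\<^sup>e\<close>, and vice versa; the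
  terms \<open>q\<^sup>b/p\<^sup>e\<close> and \<open>p\<^sup>a/q\<^sup>e\<close> used here have exponents outside the strip.
\<close>

lemma complete_to_integer:
  assumes "finite X" "e > 0"
  shows "\<exists>Y k. finite Y \<and> Y \<inter> (X \<union> strip) = {} \<and>
    real u / real (p ^ e * q ^ e) + sum val Y = real k"
proof -
  obtain R where R: "R > p" "\<And>a b. (a, b) \<in> X \<Longrightarrow> \<bar>a\<bar> < int R \<and> \<bar>b\<bar> < int R"
    using bounded_coordinates[OF assms(1), of p] by blast
  have pos: "p ^ e > 0" "q ^ e > 0" using pq_gt_1 by auto
  \<comment> \<open>With \<open>y\<close> inverse to \<open>s\<close>, the choice
    \<open>x = y * (n * (m - 1))\<close> works because \<open>n + n * (m - 1) = m * n\<close>; this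
    stays within the natural numbers.\<close>
  have solve: "\<exists>x. [n + x * s = 0] (mod m)" if "coprime s m" "m > 0" for n s m :: nat
  proof -
    obtain y where "[s * y = Suc 0] (mod m)" using cong_solve_coprime_nat[OF \<open>coprime s m\<close>] by blast
    then have "[n + (s * y) * (n * (m - 1)) = n + Suc 0 * (n * (m - 1))] (mod m)"
      by (intro cong_add cong_mult) auto
    also have "n + Suc 0 * (n * (m - 1)) = m * n"
      using \<open>m > 0\<close> by (cases m) auto
    also have "[m * n = 0] (mod m)" by (simp add: cong_0_iff)
    finally show ?thesis by (intro exI[of _ "y * (n * (m - 1))"]) (simp add: mult_ac)
  qed
  obtain x where x: "[u + x * q ^ e = 0] (mod p ^ e)"
    using solve[of "q ^ e" "p ^ e"] coprime_pq pos by (auto simp: coprime_commute)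
  obtain B where B: "finite B" "\<And>b. b \<in> B \<Longrightarrow> R \<le> b" "[(\<Sum>b\<in>B. q ^ b) = x] (mod p ^ e)"
    using sum_powers_cong[of q "p ^ e" R x] coprime_pq pos by (auto simp: coprime_commute)
  obtain y where y: "[u + y * p ^ e = 0] (mod q ^ e)"
    using solve[of "p ^ e" "q ^ e"] coprime_pq pos by auto
  obtain A where A: "finite A" "\<And>a. a \<in> A \<Longrightarrow> R \<le> a" "[(\<Sum>a\<in>A. p ^ a) = y] (mod q ^ e)"
    using sum_powers_cong[of p "q ^ e" R y] coprime_pq pos by auto
  \<comment> \<open>The numerator over \<open>p ^ e * q ^ e\<close>. Modulo \<open>p ^ e\<close> the
    sum over \<open>A\<close> vanishes and the sum over \<open>B\<close> cancels \<open>u\<close>;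
    modulo \<open>q ^ e\<close> the roles are exchanged.\<close>
  define s where "s = u + (\<Sum>b\<in>B. q ^ b) * q ^ e + (\<Sum>a\<in>A. p ^ a) * p ^ e"
  have "[s = u + x * q ^ e + 0] (mod p ^ e)"
    unfolding s_def using B(3) by (intro cong_add cong_mult) (auto simp: cong_0_iff)
  with x have "p ^ e dvd s" by (metis add_0_right cong_0_iff cong_trans)
  moreover have "[s = u + 0 + y * p ^ e] (mod q ^ e)"
    unfolding s_def using A(3) by (intro cong_add cong_mult) (auto simp: cong_0_iff)
  with y have "q ^ e dvd s" by (metis add_0_right cong_0_iff cong_trans)
  ultimately have "p ^ e * q ^ e dvd s"
    using coprime_pq by (intro divides_mult) auto
  then obtain k where k: "s = p ^ e * q ^ e * k" by auto
  \<comment> \<open>The trivial differences bring the vectors into the form to which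
    \<open>val_diff\<close> and \<open>val_nat\<close> apply.\<close>
  define Y1 where "Y1 = (\<lambda>b. (int 0 - int e, int b - int 0)) ` B"
  define Y2 where "Y2 = (\<lambda>a. (int a - int 0, int 0 - int e)) ` A"
  have fin: "finite Y1" "finite Y2" using A B by (auto simp: Y1_def Y2_def)
  have s1: "sum val Y1 = real (\<Sum>b\<in>B. q ^ b) / real (p ^ e)"
    unfolding Y1_def by (subst sum.reindex)
      (auto simp: inj_on_def val_diff val_nat sum_divide_distrib simp del: of_nat_0 diff_0 diff_0_right)
  have s2: "sum val Y2 = real (\<Sum>a\<in>A. p ^ a) / real (q ^ e)"
    unfolding Y2_def by (subst sum.reindex)
      (auto simp: inj_on_def val_diff val_nat sum_divide_distrib simp del: of_nat_0 diff_0 diff_0_right)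
  \<comment> \<open>As \<open>e > 0\<close>, the first exponent is negative in \<open>Y1\<close> and
    nonnegative in \<open>Y2\<close>.\<close>
  have "Y1 \<inter> Y2 = {}" using \<open>e > 0\<close> by (auto simp: Y1_def Y2_def)
  with fin have "sum val (Y1 \<union> Y2) = sum val Y1 + sum val Y2" by (intro sum.union_disjoint)
  also have "real u / real (p ^ e * q ^ e) + \<dots> = real s / real (p ^ e * q ^ e)"
    unfolding s1 s2 s_def using pq_gt_1 by (simp add: field_simps)
  also have "\<dots> = real k" using pos by (simp add: k)
  finally have "real u / real (p ^ e * q ^ e) + sum val (Y1 \<union> Y2) = real k" .
  moreover have "(Y1 \<union> Y2) \<inter> (X \<union> strip) = {}"
    using R A(2) B(2) \<open>e > 0\<close> by (force simp: Y1_def Y2_def)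
  ultimately show ?thesis using fin by (intro exI[of _ "Y1 \<union> Y2"] exI[of _ k]) auto
qed

text \<open>The value \<open>p ^ m\<close> is assembled from three disjoint parts and then divided
  by \<open>p ^ m\<close>: \<open>Y\<close> completes \<open>c\<close> to an integer
  \<open>k\<close>, \<open>J\<close> in the strip approximates \<open>p ^ m - k\<close> from below
  within \<open>q ^ p\<close>, and \<open>W\<close>, taken from \<open>X\<close>, contributes
  \<open>c\<close> plus the exact remainder.\<close>

lemma one_as_sum_avoiding:
  assumes "x0 > (0 :: nat)"
  shows "\<exists>E. finite E \<and> E \<subseteq> range val \<inter> {0<..<1} \<and> \<Sum>E = 1 \<and> 1 / real x0 \<notin> E"
proof -
  obtain X c where X: "finite X" "X \<inter> strip = {}"
    and sums: "\<And>j. j \<le> q ^ p \<Longrightarrow> \<exists>U\<subseteq>X. sum val U = c + real j"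
    using consecutive_sums[of "q ^ p"] by blast
  obtain U0 where "U0 \<subseteq> X" "sum val U0 = c + real 0" using sums[of 0] by blast
  then obtain u e where e: "e > 0" "c = real u / real (p ^ e * q ^ e)"
    using sum_val_common_denominator[of U0] finite_subset[OF _ X(1)] by (metis add_0_right of_nat_0)
  obtain Y k where Y: "finite Y" "Y \<inter> (X \<union> strip) = {}" "c + sum val Y = real k"
    using complete_to_integer[OF X(1) e(1), of u] e(2) by blast
  \<comment> \<open>As \<open>m < p ^ m\<close>, the first summand gives \<open>k < p ^ m\<close>,
    and the second makes \<open>x0\<close> times any value from \<open>X \<union> Y\<close> smaller
    than \<open>p ^ m\<close>.\<close>
  define m where "m = k + nat \<lceil>real x0 * sum val (X \<union> Y)\<rceil>"
  have m_lt: "m < p ^ m" using power_gt_expt[of p m] pq_gt_1 by simp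
  obtain U where U: "finite U" "U \<subseteq> {p ^ a * q ^ b | a b. 1 \<le> b \<and> b \<le> p}"
    "\<Sum>U \<le> p ^ m - k" "p ^ m - k \<le> \<Sum>U + q ^ p"
    using band_subset_sums_bounded_gaps by blast
  obtain W where W: "W \<subseteq> X" "sum val W = c + real (p ^ m - k - \<Sum>U)"
    using sums[of "p ^ m - k - \<Sum>U"] U(4) by (metis add.commute le_diff_conv)
  define J where "J = {(int a, int b) | a b. 1 \<le> b \<and> b \<le> p \<and> p ^ a * q ^ b \<in> U}"
  have inj: "inj_on val C" for C by (auto simp: inj_on_def val_eq_iff)
  have img: "val ` J = real ` U"
    using U(2) by (force simp: J_def val_nat image_iff)
  then have "finite J"
    using U(1) by (metis finite_imageD finite_imageI inj)
  have "sum val J = \<Sum>(val ` J)" by (simp add: sum.reindex[OF inj])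
  also have "\<dots> = real (\<Sum>U)" unfolding img by (subst sum.reindex) auto
  finally have sJ: "sum val J = real (\<Sum>U)" .
  have finW: "finite W" using W X finite_subset by blast
  have Js: "J \<subseteq> strip" by (auto simp: J_def)
  define D where "D = W \<union> Y \<union> J"
  have finD: "finite D" using finW Y \<open>finite J\<close> by (simp add: D_def)
  have "sum val D = sum val W + sum val Y + sum val J"
    unfolding D_def using finW Y \<open>finite J\<close> W X Js
    by (subst sum.union_disjoint, simp, simp, blast, subst sum.union_disjoint) auto
  also have "\<dots> = real k + real (p ^ m - k)"
    using U(3) Y(3) unfolding W(2) sJ by (simp only: of_nat_diff[OF U(3)])
  also have "\<dots> = real (p ^ m)"
    using m_lt by (simp add: m_def)
  finally have sD: "sum val D = real (p ^ m)" .
  \<comment> \<open>Used for \<open>x = x0\<close>, the fraction to be omitted, and for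
    \<open>x = 1\<close>, which keeps all terms below 1. Values from \<open>J\<close> contain a
    factor \<open>q\<close>; the others are too small.\<close>
  have avoid: "real x * val z \<noteq> real (p ^ m)" if z: "z \<in> D" and x: "1 \<le> x" "x \<le> x0" for x z
  proof (cases "z \<in> J")
    case True
    then obtain a b where ab: "z = (int a, int b)" "1 \<le> b" by (auto simp: J_def)
    show ?thesis
    proof
      assume "real x * val z = real (p ^ m)"
      then have "x * (p ^ a * q ^ b) = p ^ m"
        unfolding ab val_nat by (metis of_nat_eq_iff of_nat_mult)
      moreover have "q dvd x * (p ^ a * q ^ b)" using ab(2) by (simp add: dvd_power)
      ultimately have "q dvd p ^ m" by metis
      then show False using p q pq by (metis prime_dvd_power primes_dvd_imp_eq)
    qed
  next
    case False
    then have "z \<in> X \<union> Y" using z W by (auto simp: D_def)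
    then have "val z \<le> sum val (X \<union> Y)"
      using X Y val_pos by (intro member_le_sum) (auto simp: less_imp_le)
    then have "real x * val z \<le> real x0 * sum val (X \<union> Y)"
      using x val_pos[of z] by (intro mult_mono) auto
    also have "\<dots> \<le> real m" unfolding m_def by linarith
    also have "\<dots> < real (p ^ m)" using m_lt by linarith
    finally show ?thesis by simp
  qed
  define E where "E = (\<lambda>z. val (fst z - int m, snd z - int 0)) ` D"
  have shift: "val (fst z - int m, snd z - int 0) = val z / real (p ^ m)" for z
    unfolding val_diff val_nat by simp
  have pm: "real (p ^ m) > 0" using pq_gt_1 by simp
  have "inj_on (\<lambda>z. val (fst z - int m, snd z - int 0)) D"
    by (auto simp: inj_on_def val_eq_iff prod_eq_iff)
  then have "\<Sum>E = (\<Sum>z\<in>D. val z / real (p ^ m))"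
    unfolding E_def by (simp only: sum.reindex shift o_def)
  also have "\<dots> = 1" using sD pm by (simp add: sum_divide_distrib[symmetric])
  finally have sE: "\<Sum>E = 1" .
  have finE: "finite E" using finD by (simp add: E_def)
  have Epos: "x > 0" if "x \<in> E" for x using that val_pos by (auto simp: E_def)
  have notin: "1 / real x \<notin> E" if "1 \<le> x" "x \<le> x0" for x
  proof
    assume "1 / real x \<in> E"
    then obtain z where "z \<in> D" "1 / real x = val z / real (p ^ m)"
      unfolding E_def shift by blast
    then show False using avoid[of z x] that pm by (simp add: field_simps del: of_nat_power)
  qed
  have "x < 1" if "x \<in> E" for x
  proof -
    have "x \<le> \<Sum>E" using that finE Epos by (intro member_le_sum) (auto simp: less_imp_le)
    moreover have "x \<noteq> 1" using notin[of 1] assms that by auto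
    ultimately show ?thesis using sE by simp
  qed
  moreover have "E \<subseteq> range val" by (auto simp: E_def)
  moreover have "1 / real x0 \<notin> E" using notin[of x0] assms by simp
  ultimately show ?thesis
    using finE sE Epos by (intro exI[of _ E]) auto
qed

end

section \<open>Sets of reals in \<open>(0, 1)\<close> with sum 1\<close>

text \<open>In this form closure under products and divisors is immediate. From right to left, one
  prime factor is split off at a time and its exponent raised by one.\<close>

lemma mem_S_iff:
  assumes "\<forall>i\<in>{1..t}. prime (p i)"
  shows "x \<in> S t p \<longleftrightarrow> x > 0 \<and> (\<forall>r. prime r \<longrightarrow> r dvd x \<longrightarrow> r \<in> p ` {1..t})"
proof
  assume "x \<in> S t p"
  then obtain a where x: "x = (\<Prod>i=1..t. p i ^ a i)" by (auto simp: S_def)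
  have "x > 0" unfolding x using assms by (intro prod_pos) (simp add: prime_gt_0_nat)
  moreover have "r \<in> p ` {1..t}" if "prime r" "r dvd x" for r
  proof -
    have "\<exists>i\<in>{1..t}. r dvd p i ^ a i"
      using that prime_dvd_prod_iff[of "{1..t}" r] unfolding x by simp
    then obtain i where i: "i \<in> {1..t}" "r dvd p i ^ a i" by blast
    then have "r = p i" using assms that by (metis prime_dvd_power primes_dvd_imp_eq)
    with i show ?thesis by blast
  qed
  ultimately show "x > 0 \<and> (\<forall>r. prime r \<longrightarrow> r dvd x \<longrightarrow> r \<in> p ` {1..t})" by blast
next
  assume "x > 0 \<and> (\<forall>r. prime r \<longrightarrow> r dvd x \<longrightarrow> r \<in> p ` {1..t})"
  then show "x \<in> S t p"
  proof (induction x rule: less_induct)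
    case (less x)
    show ?case
    proof (cases "x = 1")
      case True
      then show ?thesis by (auto simp: S_def intro!: exI[of _ "\<lambda>_. 0"])
    next
      case False
      then obtain r where r: "prime r" "r dvd x" using prime_factor_nat by blast
      then have "r \<in> p ` {1..t}" using less.prems by blast
      then obtain i where i: "i \<in> {1..t}" "r = p i" by blast
      obtain y where y: "x = r * y" using r(2) by (rule dvdE)
      have "y \<in> S t p"
        using less.prems r prime_gt_1_nat[OF r(1)] by (intro less.IH) (auto simp: y)
      then obtain a where a: "y = (\<Prod>i=1..t. p i ^ a i)" by (auto simp: S_def)
      have "(\<Prod>j=1..t. p j ^ (a(i := Suc (a i))) j) = (\<Prod>j=1..t. (if j = i then p i else 1) * p j ^ a j)"
        by (intro prod.cong) auto
      also have "\<dots> = x" using i by (simp add: prod.distrib y a)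
      finally show ?thesis unfolding S_def by blast
    qed
  qed
qed

text \<open>The ambient set is a parameter because two are needed: the reciprocals of elements of
  \<open>S t p\<close>, and the numbers that become such reciprocals after scaling.\<close>

definition unity_sets :: "real set \<Rightarrow> real set set" where
  "unity_sets G = {D. finite D \<and> D \<subseteq> G \<inter> {0<..<1} \<and> \<Sum>D = 1}"

lemma unity_sets_mono: "G \<subseteq> H \<Longrightarrow> unity_sets G \<subseteq> unity_sets H"
  by (auto simp: unity_sets_def)

lemma unity_setsD:
  assumes "D \<in> unity_sets G"
  shows "finite D" "D \<subseteq> G" "\<And>d. d \<in> D \<Longrightarrow> 0 < d \<and> d < 1" "\<Sum>D = 1" "D \<noteq> {}" "Min D \<in> D" "Max D \<in> D"
proof -
  show D: "finite D" "D \<subseteq> G" "\<And>d. d \<in> D \<Longrightarrow> 0 < d \<and> d < 1" "\<Sum>D = 1" "D \<noteq> {}"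
    using assms by (auto simp: unity_sets_def)
  show "Min D \<in> D" "Max D \<in> D" using D by simp_all
qed

lemma unity_sets_card:
  assumes "D \<in> unity_sets G"
  shows "card D \<ge> 2"
proof (rule ccontr)
  assume "\<not> card D \<ge> 2"
  then have "card D = 1"
    using unity_setsD(1,5)[OF assms] by (metis One_nat_def Suc_1 card_0_eq le_antisym not_less_eq_eq not_gr0 Suc_leI)
  then obtain d where "D = {d}" by (rule card_1_singletonE)
  then show False using unity_setsD(3,4)[OF assms] by auto
qed

lemma unity_sets_expand:
  assumes D: "D \<in> unity_sets G" and E: "E \<in> unity_sets H" and m: "m \<in> D"
    and sub: "(*) m ` E \<subseteq> G" and disj: "(*) m ` E \<inter> D = {}"
  shows "(D - {m}) \<union> (*) m ` E \<in> unity_sets G"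
    and "card ((D - {m}) \<union> (*) m ` E) = card D + card E - 1"
proof -
  note D' = unity_setsD[OF D] and E' = unity_setsD[OF E]
  have m01: "0 < m" "m < 1" using D'(3) m by auto
  then have inj: "inj_on ((*) m) E" by (auto simp: inj_on_def)
  have "\<Sum>((D - {m}) \<union> (*) m ` E) = \<Sum>(D - {m}) + \<Sum>((*) m ` E)"
    using D'(1) E'(1) disj by (intro sum.union_disjoint) auto
  also have "\<Sum>(D - {m}) = 1 - m" using D'(1,4) m by (simp add: sum_diff1)
  also have "\<Sum>((*) m ` E) = m * \<Sum>E" using inj by (simp add: sum.reindex sum_distrib_left)
  also have "1 - m + m * \<Sum>E = 1" using E'(4) by simp
  finally have sum: "\<Sum>((D - {m}) \<union> (*) m ` E) = 1" .
  have "m * e < 1 * 1" if "e \<in> E" for e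
    using E'(3)[OF that] m01 by (intro mult_strict_mono) auto
  then show "(D - {m}) \<union> (*) m ` E \<in> unity_sets G"
    using D' E' m01 sub sum by (auto simp: unity_sets_def)
  have "card ((D - {m}) \<union> (*) m ` E) = card (D - {m}) + card ((*) m ` E)"
    using D'(1) E'(1) disj by (intro card_Un_disjoint) auto
  also have "\<dots> = card D - 1 + card E"
    using m inj by (simp add: card_image card_Diff_singleton)
  also have "\<dots> = card D + card E - 1"
    using D'(1,5) by (simp add: Suc_leI card_gt_0_iff)
  finally show "card ((D - {m}) \<union> (*) m ` E) = card D + card E - 1" .
qed

text \<open>The least element is the one to expand because all new terms then lie below all
  remaining old ones: nothing collides, and old and new terms can be told apart.\<close>

definition graft :: "real set \<Rightarrow> real set \<Rightarrow> real set" where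
  "graft D E = (D - {Min D}) \<union> (*) (Min D) ` E"

lemma scaled_Min_less:
  assumes "D \<in> unity_sets G" "E \<in> unity_sets H" "x \<in> (*) (Min D) ` E"
  shows "x < Min D"
proof -
  obtain e where e: "e \<in> E" "x = Min D * e" using assms(3) by blast
  have "0 < Min D" "e < 1"
    using unity_setsD(3)[OF assms(2) e(1)] unity_setsD(3)[OF assms(1) unity_setsD(6)[OF assms(1)]] by simp_all
  then show ?thesis by (simp add: e)
qed

lemma graft_in_unity_sets:
  assumes D: "D \<in> unity_sets G" and E: "E \<in> unity_sets H" and sub: "(*) (Min D) ` E \<subseteq> G"
  shows "graft D E \<in> unity_sets G" "card (graft D E) = card D + card E - 1"
proof -
  have "(*) (Min D) ` E \<inter> D = {}"
    using scaled_Min_less[OF D E] unity_setsD(1)[OF D] by (meson Int_emptyI Min_le leD)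
  from unity_sets_expand[OF D E unity_setsD(6)[OF D] sub this]
  show "graft D E \<in> unity_sets G" "card (graft D E) = card D + card E - 1"
    by (simp_all add: graft_def)
qed

lemma Min_graft:
  assumes D: "D \<in> unity_sets G" and E: "E \<in> unity_sets H"
  shows "Min (graft D E) = Min D * Min E"
proof (rule Min_eqI)
  note D' = unity_setsD[OF D] and E' = unity_setsD[OF E]
  show "finite (graft D E)" using D'(1) E'(1) by (simp add: graft_def)
  show in_graft: "Min D * Min E \<in> graft D E" unfolding graft_def using E'(6) by (intro UnI2 imageI)
  fix y assume "y \<in> graft D E"
  then consider "y \<in> D" | e where "e \<in> E" "y = Min D * e" by (auto simp: graft_def)
  then show "Min D * Min E \<le> y"
  proof cases
    case 1
    have "Min D * Min E < Min D" using scaled_Min_less[OF D E] E'(6) by blast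
    also have "\<dots> \<le> y" using 1 D'(1) by simp
    finally show ?thesis by simp
  next
    case 2
    then show ?thesis using D'(3)[OF D'(6)] E'(1) by (simp add: mult_left_mono)
  qed
qed

text \<open>The old parts \<open>D - {Min D}\<close> and \<open>D' - {Min D'}\<close> are upper
  segments of the same set, hence nested, and equal since their sizes agree. The total 1 recovers
  the minimum, and dividing the lower part by it recovers \<open>E\<close>.\<close>

lemma graft_inject:
  assumes D: "D \<in> unity_sets G" "D' \<in> unity_sets G" "card D = card D'"
    and E: "E \<in> unity_sets H" "E' \<in> unity_sets H" and eq: "graft D E = graft D' E'"
  shows "D = D' \<and> E = E'"
proof -
  have upper: "y \<in> C - {Min C}"
    if "C \<in> unity_sets G" "F \<in> unity_sets H" "x \<in> C - {Min C}" "y \<in> graft C F" "x \<le> y" for C F x y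
  proof (rule ccontr)
    assume "y \<notin> C - {Min C}"
    then have "y < Min C" using that scaled_Min_less[OF that(1,2)] by (auto simp: graft_def)
    also have "Min C \<le> x" using that unity_setsD(1)[OF that(1)] by simp
    finally show False using \<open>x \<le> y\<close> by simp
  qed
  have sub: "D - {Min D} \<subseteq> graft D E" "D' - {Min D'} \<subseteq> graft D' E'" by (auto simp: graft_def)
  have "D - {Min D} \<subseteq> D' - {Min D'} \<or> D' - {Min D'} \<subseteq> D - {Min D}"
  proof (rule ccontr)
    assume "\<not> ?thesis"
    then obtain x y where xy: "x \<in> D - {Min D}" "x \<notin> D' - {Min D'}" "y \<in> D' - {Min D'}" "y \<notin> D - {Min D}" by blast
    show False
    proof (cases "x \<le> y")
      case True
      then show False using upper[OF D(1) E(1) xy(1) _ True] xy sub eq by blast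
    next
      case False
      then have "y \<le> x" by simp
      then show False using upper[OF D(2) E(2) xy(3)] xy sub eq by blast
    qed
  qed
  moreover have "card (D - {Min D}) = card (D' - {Min D'})"
    using D unity_setsD(1,6)[OF D(1)] unity_setsD(1,6)[OF D(2)] by (simp add: card_Diff_singleton)
  ultimately have top: "D - {Min D} = D' - {Min D'}"
    using unity_setsD(1)[OF D(1)] unity_setsD(1)[OF D(2)] by (metis card_subset_eq finite_Diff)
  have s: "\<Sum>(C - {Min C}) = 1 - Min C" if "C \<in> unity_sets G" for C
    using unity_setsD[OF that] by (simp add: sum_diff1)
  have min: "Min D = Min D'" using s[OF D(1)] s[OF D(2)] top by simp
  have "D = insert (Min D) (D - {Min D})" "D' = insert (Min D') (D' - {Min D'})"
    using unity_setsD(6)[OF D(1)] unity_setsD(6)[OF D(2)] by auto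
  with top min have DD: "D = D'" by metis
  have img: "(*) (Min C) ` F = graft C F - (C - {Min C})"
    if "C \<in> unity_sets G" "F \<in> unity_sets H" for C F
    using scaled_Min_less[OF that] unity_setsD(1)[OF that(1)] by (auto simp: graft_def) (meson Min_le imageI leD)
  have "(*) (Min D) ` E = (*) (Min D) ` E'"
    using img[OF D(1) E(1)] img[OF D(2) E(2)] eq DD by simp
  moreover have "inj ((*) (Min D))"
    using unity_setsD(3)[OF D(1) unity_setsD(6)[OF D(1)]] by (auto simp: inj_def)
  ultimately show ?thesis using DD by (simp add: inj_image_eq_iff)
qed

text \<open>Shows later that the denominators of a solution cannot all be powers of one
  prime.\<close>

lemma sum_inverse_powers_less_1:
  assumes "r \<ge> (2 :: nat)"
  shows "(\<Sum>i\<in>{1..k}. 1 / real (r ^ i)) < 1"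
proof -
  have "(\<Sum>i\<in>{1..k}. 1 / real (r ^ i)) \<le> (\<Sum>i\<in>{1..k}. (1 / 2) ^ i)"
  proof (rule sum_mono)
    fix i
    have "(2 :: real) ^ i \<le> real r ^ i" using assms by (intro power_mono) auto
    then show "1 / real (r ^ i) \<le> (1 / 2) ^ i" by (simp add: power_one_over frac_le)
  qed
  also have "\<dots> = 1 - (1 / 2) ^ k" by (induction k) auto
  also have "\<dots> < 1" by simp
  finally show ?thesis .
qed

section \<open>Solutions as sets of unit fractions\<close>

context
  fixes t :: nat and p :: "nat \<Rightarrow> nat"
  assumes primes: "\<forall>i\<in>{1..t}. prime (p i)"
begin

definition unit_fractions :: "real set" where
  "unit_fractions = (\<lambda>x. 1 / real x) ` S t p"

abbreviation sols :: "real set set" where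
  "sols \<equiv> unity_sets unit_fractions"

lemma S_pos: "x \<in> S t p \<Longrightarrow> x > 0"
  unfolding mem_S_iff[OF primes] by blast

lemma S_mult: "x \<in> S t p \<Longrightarrow> y \<in> S t p \<Longrightarrow> x * y \<in> S t p"
  unfolding mem_S_iff[OF primes] using prime_dvd_mult_iff by (metis nat_0_less_mult_iff)

lemma S_dvd: "x \<in> S t p \<Longrightarrow> y dvd x \<Longrightarrow> y \<in> S t p"
proof -
  assume x: "x \<in> S t p" and y: "y dvd x"
  have "y > 0" using S_pos[OF x] y by (rule dvd_pos_nat)
  moreover have "r \<in> p ` {1..t}" if "prime r" "r dvd y" for r
    using x that dvd_trans[OF that(2) y] unfolding mem_S_iff[OF primes] by blast
  ultimately show ?thesis unfolding mem_S_iff[OF primes] by blast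
qed

lemma unit_fractions_mult:
  "x \<in> unit_fractions \<Longrightarrow> y \<in> unit_fractions \<Longrightarrow> x * y \<in> unit_fractions"
proof -
  assume "x \<in> unit_fractions" "y \<in> unit_fractions"
  then obtain a b where "a \<in> S t p" "x = 1 / real a" "b \<in> S t p" "y = 1 / real b"
    unfolding unit_fractions_def by blast
  then show ?thesis
    unfolding unit_fractions_def by (intro image_eqI[of _ _ "a * b"] S_mult) auto
qed

text \<open>A strictly increasing list is determined by its set of entries, and taking reciprocals
  is injective.\<close>

lemma bij_betw_solutions:
  "bij_betw (\<lambda>xs. (\<lambda>x. 1 / real x) ` set xs) (solutions t p k) {D \<in> sols. card D = k}"
proof -
  let ?f = "\<lambda>x :: nat. 1 / real x"
  have inj: "inj_on ?f X" if "\<forall>x\<in>X. x > 0" for X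
    using that by (auto simp: inj_on_def)
  \<comment> \<open>This includes the argument 0, where \<open>1 / 0 = 0\<close>.\<close>
  have "inj ?f" by (auto simp: inj_def)
  show ?thesis
    unfolding bij_betw_def
  proof (intro conjI inj_onI equalityI subsetI)
    fix xs ys assume *: "xs \<in> solutions t p k" "ys \<in> solutions t p k" "?f ` set xs = ?f ` set ys"
    then have "set xs = set ys" using \<open>inj ?f\<close> by (simp add: inj_image_eq_iff)
    with * show "xs = ys" by (simp add: solutions_def strict_sorted_equal)
  next
    fix D assume "D \<in> (\<lambda>xs. ?f ` set xs) ` solutions t p k"
    then obtain xs where D: "D = ?f ` set xs" and xs: "length xs = k" "sorted_wrt (<) xs"
      "\<forall>x\<in>set xs. 1 < x \<and> x \<in> S t p" "(\<Sum>x\<leftarrow>xs. 1 / real x) = 1" by (auto simp: solutions_def)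
    have dist: "distinct xs" using xs(2) by (simp add: strict_sorted_iff)
    have inj': "inj_on ?f (set xs)" using \<open>inj ?f\<close> by (auto simp: inj_on_def)
    have "card D = k" unfolding D using xs(1) dist inj' by (simp add: card_image distinct_card)
    moreover have "\<Sum>D = 1" unfolding D using xs(4) dist inj'
      by (simp add: sum.reindex sum_list_distinct_conv_sum_set)
    ultimately show "D \<in> {D \<in> sols. card D = k}"
      using xs(3) by (auto simp: D unity_sets_def unit_fractions_def)
  next
    fix D assume "D \<in> {D \<in> sols. card D = k}"
    then have D: "finite D" "D \<subseteq> unit_fractions" "\<And>d. d \<in> D \<Longrightarrow> 0 < d \<and> d < 1" "\<Sum>D = 1" "card D = k"
      by (auto dest: unity_setsD)
    obtain X where X: "X \<subseteq> S t p" "D = ?f ` X"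
      using D(2) unfolding unit_fractions_def by (auto simp: subset_image_iff)
    have inj': "inj_on ?f X" using \<open>inj ?f\<close> by (auto simp: inj_on_def)
    have fin: "finite X" using D(1) X(2) inj' finite_imageD by blast
    have "1 < x" if "x \<in> X" for x
    proof -
      have "?f x \<in> D" using X(2) that by blast
      from D(3)[OF this] show ?thesis by (cases "x = 1") auto
    qed
    moreover have "(\<Sum>x\<leftarrow>sorted_list_of_set X. 1 / real x) = 1"
      using D(4) X(2) inj' fin by (simp add: sum_list_distinct_conv_sum_set sum.reindex)
    moreover have "card X = k" using D(5) X(2) inj' by (simp add: card_image)
    ultimately have "sorted_list_of_set X \<in> solutions t p k"
      using X(1) fin by (auto simp: solutions_def)
    then show "D \<in> (\<lambda>xs. ?f ` set xs) ` solutions t p k"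
      using X(2) fin by (intro image_eqI[of _ _ "sorted_list_of_set X"]) auto
  qed
qed

lemma T_eq_card: "T t p k = card {D \<in> sols. card D = k}"
  unfolding T_def by (rule bij_betw_same_card[OF bij_betw_solutions])

lemma finite_sols: "finite {D \<in> sols. card D = k}"
  using bij_betw_finite[OF bij_betw_solutions] finite_solutions by blast

lemma mem_K_iff: "k \<in> K t p \<longleftrightarrow> (\<exists>D\<in>sols. card D = k)"
proof
  assume "k \<in> K t p"
  then have "{D \<in> sols. card D = k} \<noteq> {}"
    unfolding K_def T_eq_card by (metis (no_types, lifting) card.empty mem_Collect_eq not_one_le_zero)
  then show "\<exists>D\<in>sols. card D = k" by blast
next
  assume *: "\<exists>D\<in>sols. card D = k"
  then have "k \<ge> 2" using unity_sets_card by blast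
  moreover have "card {D \<in> sols. card D = k} > 0"
    using * finite_sols by (auto simp: card_gt_0_iff)
  ultimately show "k \<in> K t p" unfolding K_def T_eq_card by simp
qed

lemma T_mult_le: "T t p k * T t p m \<le> T t p (k + m - 1)"
proof -
  let ?A = "\<lambda>k. {D \<in> sols. card D = k}"
  have "card (?A k \<times> ?A m) \<le> card (?A (k + m - 1))"
  proof (rule card_inj_on_le[of "\<lambda>(D, E). graft D E"])
    show "inj_on (\<lambda>(D, E). graft D E) (?A k \<times> ?A m)"
    proof (rule inj_onI, clarify)
      fix D E D' E'
      assume "D \<in> sols" "E \<in> sols" "D' \<in> sols" "E' \<in> sols"
        and "card D' = card D" "card E' = card E" "graft D E = graft D' E'"
      then show "D = D' \<and> E = E'" by (intro graft_inject) simp_all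
    qed
    show "(\<lambda>(D, E). graft D E) ` (?A k \<times> ?A m) \<subseteq> ?A (k + m - 1)"
    proof clarify
      fix D E assume D: "D \<in> sols" and E: "E \<in> sols"
      have "(*) (Min D) ` E \<subseteq> unit_fractions"
        using unity_setsD(2,6)[OF D] unity_setsD(2)[OF E] unit_fractions_mult by blast
      from graft_in_unity_sets[OF D E this]
      show "graft D E \<in> sols \<and> card (graft D E) = card D + card E - 1" by blast
    qed
  qed (rule finite_sols)
  then show ?thesis by (simp add: T_eq_card card_cartesian_product)
qed

lemma K_closed: "k \<in> K t p \<Longrightarrow> m \<in> K t p \<Longrightarrow> k + (m - 1) \<in> K t p"
  using T_mult_le[of k m] by (auto simp: K_def) (metis One_nat_def Suc_leI mult_le_mono le_trans nat_mult_1)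

section \<open>Two solutions of the same size\<close>

text \<open>Both expansions of \<open>D\<close> by itself have \<open>2 * card D - 1\<close>
  elements. Expanding \<open>m\<close> removes it, and disjointness keeps it from reappearing;
  expanding the least element leaves \<open>m\<close> in place.\<close>

lemma two_maximal_expansions:
  assumes D: "D \<in> sols" and m: "m \<in> D" "m \<noteq> Min D" and disj: "(*) m ` D \<inter> D = {}"
  shows "\<exists>E\<in>sols. \<exists>F\<in>sols. E \<noteq> F \<and> card E = card F"
proof -
  note D' = unity_setsD[OF D]
  have sub: "(*) x ` D \<subseteq> unit_fractions" if "x \<in> D" for x
    using that D'(2) unit_fractions_mult by blast
  let ?E = "(D - {m}) \<union> (*) m ` D"
  have "m \<notin> (*) m ` D" using m(1) disj by blast
  then have "m \<notin> ?E" by blast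
  moreover have "m \<in> graft D D" using m by (simp add: graft_def)
  ultimately have "?E \<noteq> graft D D" by blast
  then show ?thesis
    using unity_sets_expand[OF D D m(1) sub[OF m(1)] disj] graft_in_unity_sets[OF D D sub[OF D'(6)]]
    by (intro bexI[of _ ?E] bexI[of _ "graft D D"]) simp_all
qed

text \<open>Let \<open>Min A\<close> be the least element of \<open>D\<close> that is
  \<open>d\<close> times a unit fraction. If it were not \<open>Min D\<close>, a collision would put
  the smaller product \<open>Min A * f\<close> into \<open>D\<close>.\<close>

lemma all_divide_Min:
  assumes D: "D \<in> sols" and coll: "\<And>m. m \<in> D \<Longrightarrow> m \<noteq> Min D \<Longrightarrow> (*) m ` D \<inter> D \<noteq> {}"
    and d: "d \<in> D"
  shows "\<exists>e\<in>unit_fractions. Min D = d * e"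
proof -
  note D' = unity_setsD[OF D]
  define A where "A = {x \<in> D. \<exists>e\<in>unit_fractions. x = d * e}"
  have "1 \<in> unit_fractions"
    using mem_S_iff[OF primes, of 1] by (auto simp: unit_fractions_def intro!: image_eqI[of _ _ 1])
  then have "d \<in> A" using d by (auto simp: A_def intro!: bexI[of _ 1])
  moreover have finA: "finite A" using D'(1) by (simp add: A_def)
  ultimately have "Min A \<in> A" by (metis Min_in empty_iff)
  then obtain e where e: "e \<in> unit_fractions" "Min A = d * e" "Min A \<in> D" by (auto simp: A_def)
  have "Min A = Min D"
  proof (rule ccontr)
    assume "Min A \<noteq> Min D"
    with coll[OF e(3)] obtain f where f: "f \<in> D" "Min A * f \<in> D" by blast
    have "Min A * f = d * (e * f)" by (simp add: e(2) mult.assoc)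
    moreover have "e * f \<in> unit_fractions" using e(1) f(1) D'(2) unit_fractions_mult by blast
    ultimately have "Min A * f \<in> A" using f(2) unfolding A_def by blast
    then have "Min A \<le> Min A * f" using finA by simp
    moreover have "Min A * f < Min A" using D'(3)[OF f(1)] D'(3)[OF e(3)] by simp
    ultimately show False by simp
  qed
  with e show ?thesis by auto
qed

text \<open>If \<open>N\<close> were a power of one prime \<open>r\<close>, then \<open>D\<close>
  would consist of distinct terms \<open>1 / r ^ i\<close> with \<open>i \<ge> 1\<close>, whose sum
  is below 1.\<close>

lemma two_primes_of_common_multiple:
  assumes D: "D \<in> sols" and N: "N > 0" and dvd: "\<And>d. d \<in> D \<Longrightarrow> \<exists>x. x dvd N \<and> d = 1 / real x"
  obtains r s where "prime r" "prime s" "r \<noteq> s" "r dvd N" "s dvd N"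
proof -
  note D' = unity_setsD[OF D]
  obtain x where x: "x dvd N" "Min D = 1 / real x" using dvd[OF D'(6)] by blast
  have "x \<noteq> 1" using x(2) D'(3)[OF D'(6)] by auto
  with x(1) have "N \<noteq> 1" by auto
  then obtain r where r: "prime r" "r dvd N" using prime_factor_nat by blast
  show thesis
  proof (cases "\<exists>k. N = r ^ k")
    case True
    then obtain k where k: "N = r ^ k" by blast
    have "D \<subseteq> (\<lambda>i. 1 / real (r ^ i)) ` {1..k}"
    proof
      fix d assume d: "d \<in> D"
      obtain x where x: "x dvd N" "d = 1 / real x" using dvd[OF d] by blast
      then obtain i where i: "i \<le> k" "x = r ^ i" using r(1) k by (auto simp: divides_primepow_nat)
      moreover have "i \<noteq> 0" using D'(3)[OF d] x(2) i(2) by (intro notI) simp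
      ultimately show "d \<in> (\<lambda>i. 1 / real (r ^ i)) ` {1..k}"
        using x(2) by (intro image_eqI[of _ _ i]) auto
    qed
    then have "\<Sum>D \<le> \<Sum>((\<lambda>i. 1 / real (r ^ i)) ` {1..k})"
      by (intro sum_mono2) auto
    also have "\<dots> = (\<Sum>i\<in>{1..k}. 1 / real (r ^ i))"
      using prime_gt_1_nat[OF r(1)] by (subst sum.reindex) (auto simp: inj_on_def)
    also have "\<dots> < 1"
      using prime_ge_2_nat[OF r(1)] by (rule sum_inverse_powers_less_1)
    finally show ?thesis using D'(4) by simp
  next
    case False
    then obtain s where "s \<in> prime_factors N" "s \<noteq> r"
      using Ex_other_prime_factor[of N r] N r(1) by auto
    then show ?thesis using that[of r s] r by (auto simp: prime_factors_dvd)
  qed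
qed

section \<open>Clearing denominators\<close>

definition clearable :: "real \<Rightarrow> real set" where
  "clearable \<mu> = {g. \<exists>n. \<mu> ^ n * g \<in> unit_fractions}"

lemma power_unit_fractions: "x \<in> unit_fractions \<Longrightarrow> n > 0 \<Longrightarrow> x ^ n \<in> unit_fractions"
proof (induction n)
  case (Suc n)
  then show ?case by (cases "n = 0") (auto intro: unit_fractions_mult)
qed simp

lemma clearable_more:
  assumes "\<mu> \<in> unit_fractions" "\<mu> ^ n * g \<in> unit_fractions" "n \<le> m"
  shows "\<mu> ^ m * g \<in> unit_fractions"
proof (cases "m = n")
  case False
  then have "\<mu> ^ (m - n) * (\<mu> ^ n * g) \<in> unit_fractions"
    using assms by (intro unit_fractions_mult[OF power_unit_fractions assms(2)]) auto
  then show ?thesis using assms(3) by (simp add: mult.assoc[symmetric] flip: power_add)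
qed (use assms in simp)

lemma clearable_mult: "x \<in> clearable \<mu> \<Longrightarrow> y \<in> clearable \<mu> \<Longrightarrow> x * y \<in> clearable \<mu>"
proof -
  assume "x \<in> clearable \<mu>" "y \<in> clearable \<mu>"
  then obtain m n where "\<mu> ^ m * x \<in> unit_fractions" "\<mu> ^ n * y \<in> unit_fractions"
    by (auto simp: clearable_def)
  then have "(\<mu> ^ m * x) * (\<mu> ^ n * y) \<in> unit_fractions" by (rule unit_fractions_mult)
  then have "\<mu> ^ (m + n) * (x * y) \<in> unit_fractions" by (simp add: power_add mult_ac)
  then show ?thesis by (auto simp: clearable_def)
qed

lemma unit_fractions_clearable: "unit_fractions \<subseteq> clearable \<mu>"
  by (auto simp: clearable_def intro!: exI[of _ 0])

text \<open>One factor \<open>1 / N\<close> turns \<open>r\<close> into the reciprocal of the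
  cofactor \<open>c\<close>, and \<open>1 / r\<close> is already a unit fraction; powers follow by
  multiplicativity.\<close>

lemma powi_clearable:
  assumes N: "N \<in> S t p" and r: "prime r" "r dvd N"
  shows "real r powi a \<in> clearable (1 / real N)"
proof -
  have N0: "N > 0" using N by (rule S_pos)
  have one: "1 \<in> clearable (1 / real N)"
    using N by (auto simp: clearable_def unit_fractions_def intro!: exI[of _ 1])
  have pow: "x ^ n \<in> clearable (1 / real N)" if "x \<in> clearable (1 / real N)" for x n
    using that one by (induction n) (auto intro: clearable_mult)
  obtain c where c: "N = r * c" using r(2) by (rule dvdE)
  have "c \<in> S t p" "r \<in> S t p" using S_dvd[OF N] c by auto
  moreover have "(1 / real N) ^ 1 * real r = 1 / real c"
    using N0 c prime_gt_0_nat[OF r(1)] by (simp add: field_simps)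
  ultimately have "(1 / real N) ^ 1 * real r \<in> unit_fractions" "1 / real r \<in> unit_fractions"
    unfolding unit_fractions_def by auto
  then have "real r \<in> clearable (1 / real N)" "1 / real r \<in> clearable (1 / real N)"
    using unit_fractions_clearable unfolding clearable_def by blast+
  then show ?thesis
    using pow[of "real r" "nat a"] pow[of "1 / real r" "nat (- a)"]
    by (cases "a \<ge> 0") (auto simp: power_int_def field_simps)
qed

lemma sol_with_Min_power:
  assumes D: "D \<in> sols" and "n > 0"
  shows "\<exists>F\<in>sols. Min F = Min D ^ n"
  using \<open>n > 0\<close>
proof (induction n)
  case (Suc n)
  show ?case
  proof (cases "n = 0")
    case True
    then show ?thesis using D by auto
  next
    case False
    then obtain F where F: "F \<in> sols" "Min F = Min D ^ n" using Suc by auto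
    have "(*) (Min F) ` D \<subseteq> unit_fractions"
      using unity_setsD(2,6)[OF F(1)] unity_setsD(2)[OF D] unit_fractions_mult by blast
    then have "graft F D \<in> sols" using graft_in_unity_sets[OF F(1) D] by blast
    moreover have "Min (graft F D) = Min D ^ Suc n"
      using Min_graft[OF F(1) D] F(2) by simp
    ultimately show ?thesis by blast
  qed
qed simp

lemma clear_denominators:
  assumes D: "D \<in> sols" and E: "E \<in> unity_sets (clearable (Min D))" "F \<in> unity_sets (clearable (Min D))"
    and neq: "E \<noteq> F" and card: "card E = card F"
  shows "\<exists>E\<in>sols. \<exists>F\<in>sols. E \<noteq> F \<and> card E = card F"
proof -
  note D' = unity_setsD[OF D]
  have \<mu>: "Min D \<in> unit_fractions" using D'(2,6) by blast
  have "\<exists>n. \<forall>g\<in>E \<union> F. Min D ^ n g * g \<in> unit_fractions"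
    using unity_setsD(2)[OF E(1)] unity_setsD(2)[OF E(2)]
    unfolding clearable_def by (intro bchoice) blast
  then obtain n where n: "\<And>g. g \<in> E \<union> F \<Longrightarrow> Min D ^ n g * g \<in> unit_fractions" by blast
  \<comment> \<open>One exponent for all elements: the sum dominates every \<open>n g\<close>, and
    \<open>Suc\<close> makes it positive, as \<open>sol_with_Min_power\<close> requires.\<close>
  define m where "m = Suc (\<Sum>g\<in>E \<union> F. n g)"
  have m: "Min D ^ m * g \<in> unit_fractions" if "g \<in> E \<union> F" for g
  proof (rule clearable_more[OF \<mu> n[OF that]])
    have "n g \<le> (\<Sum>g\<in>E \<union> F. n g)"
      using that unity_setsD(1)[OF E(1)] unity_setsD(1)[OF E(2)] by (intro member_le_sum) auto
    then show "n g \<le> m" by (simp add: m_def)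
  qed
  obtain C where C: "C \<in> sols" "Min C = Min D ^ m"
    using sol_with_Min_power[OF D, of m] by (auto simp: m_def)
  have sub: "(*) (Min C) ` E \<subseteq> unit_fractions" "(*) (Min C) ` F \<subseteq> unit_fractions"
    using m unfolding C(2) by blast+
  have "graft C E \<noteq> graft C F"
    using graft_inject[OF C(1) C(1) refl E] neq by blast
  then show ?thesis
    using graft_in_unity_sets[OF C(1) E(1) sub(1)] graft_in_unity_sets[OF C(1) E(2) sub(2)] card
    by (intro bexI[of _ "graft C E"] bexI[of _ "graft C F"]) simp_all
qed

lemma two_sols_same_card:
  assumes D: "D \<in> sols"
  shows "\<exists>E\<in>sols. \<exists>F\<in>sols. E \<noteq> F \<and> card E = card F"
proof (cases "\<exists>m\<in>D. m \<noteq> Min D \<and> (*) m ` D \<inter> D = {}")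
  case True
  then show ?thesis using two_maximal_expansions[OF D] by blast
next
  case False
  note D' = unity_setsD[OF D]
  define \<mu> where "\<mu> = Min D"
  obtain N where N: "N \<in> S t p" "\<mu> = 1 / real N"
    using D'(2,6) unfolding unit_fractions_def \<mu>_def by blast
  have N0: "N > 0" using S_pos[OF N(1)] .
  have "\<exists>x. x dvd N \<and> d = 1 / real x" if d: "d \<in> D" for d
  proof -
    obtain e where e: "e \<in> unit_fractions" "\<mu> = d * e"
      using all_divide_Min[OF D _ d] False unfolding \<mu>_def by blast
    obtain x y where xy: "x \<in> S t p" "d = 1 / real x" "y \<in> S t p" "e = 1 / real y"
      using d D'(2) e(1) unfolding unit_fractions_def by blast
    then have "1 / real N = 1 / real (x * y)" using e(2) N(2) by simp
    then have "real N = real (x * y)" by (metis div_by_1 divide_divide_eq_right mult_1)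
    then have "N = x * y" by (simp only: of_nat_eq_iff)
    then show ?thesis using xy(2) by (intro exI[of _ x]) simp
  qed
  then obtain r s where rs: "prime r" "prime s" "r \<noteq> s" "r dvd N" "s dvd N"
    using two_primes_of_common_multiple[OF D N0] by blast
  obtain x0 where x0: "x0 \<in> S t p" "Max D = 1 / real x0"
    using D'(2,7) unfolding unit_fractions_def by blast
  obtain E where E: "finite E" "E \<subseteq> range (val r s) \<inter> {0<..<1}" "\<Sum>E = 1" "Max D \<notin> E"
    using one_as_sum_avoiding[OF rs(1-3) S_pos[OF x0(1)]] unfolding x0(2) by blast
  have val: "val r s z \<in> clearable \<mu>" for z
    unfolding val_def[OF rs(1-3)] N(2) using N rs by (intro clearable_mult powi_clearable)
  have E': "E \<in> unity_sets (clearable \<mu>)"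
    using E val unfolding unity_sets_def by blast
  have Dc: "D \<in> unity_sets (clearable \<mu>)"
    using D unity_sets_mono[OF unit_fractions_clearable] by blast
  have sub: "(*) (Min D) ` E \<subseteq> clearable \<mu>" "(*) (Min E) ` D \<subseteq> clearable \<mu>"
    using clearable_mult unity_setsD(2,6)[OF Dc] unity_setsD(2,6)[OF E'] by blast+
  \<comment> \<open>\<open>Max D\<close> will tell the two grafts apart: it survives in
    \<open>graft D E\<close>, whereas it is not in \<open>E\<close> and exceeds every product
    \<open>Min E * d\<close>.\<close>
  have "Max D \<noteq> Min D"
  proof
    assume "Max D = Min D"
    then have "D \<subseteq> {Min D}" using D'(1) by (metis Max_ge Min_le antisym singletonI subsetI)
    then have "card D \<le> 1" using card_mono[of "{Min D}" D] by simp
    then show False using unity_sets_card[OF D] by simp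
  qed
  then have "Max D \<in> graft D E" using D'(7) by (simp add: graft_def)
  moreover have "Max D \<notin> graft E D"
  proof
    assume "Max D \<in> graft E D"
    then obtain d where d: "d \<in> D" "Max D = Min E * d" using E(4) by (auto simp: graft_def)
    have "Min E * d < 1 * d"
      using unity_setsD(3)[OF E' unity_setsD(6)[OF E']] D'(3)[OF d(1)] by (intro mult_strict_right_mono) auto
    also have "\<dots> \<le> Max D" using D'(1) d(1) by simp
    finally show False using d(2) by simp
  qed
  ultimately have "graft D E \<noteq> graft E D" by blast
  then show ?thesis
    using clear_denominators[OF D, folded \<mu>_def, OF graft_in_unity_sets(1)[OF Dc E' sub(1)]
        graft_in_unity_sets(1)[OF E' Dc sub(2)]]
      graft_in_unity_sets(2)[OF Dc E' sub(1)] graft_in_unity_sets(2)[OF E' Dc sub(2)]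
    by (simp add: add.commute)
qed

lemma ex_T_ge_2:
  assumes "K t p \<noteq> {}"
  obtains m where "m \<in> K t p" "T t p m \<ge> 2"
proof -
  obtain D where "D \<in> sols" using assms mem_K_iff by blast
  from two_sols_same_card[OF this] obtain E F
    where EF: "E \<in> sols" "F \<in> sols" "E \<noteq> F" "card E = card F" by blast
  have "card {E, F} \<le> card {D \<in> sols. card D = card E}"
    using EF by (intro card_mono finite_sols) auto
  then have "T t p (card E) \<ge> 2" using EF(3) by (simp add: T_eq_card)
  moreover have "card E \<in> K t p" using EF(1) mem_K_iff by blast
  ultimately show thesis using that by blast
qed

text \<open>Each use of \<open>T_mult_le\<close> with \<open>m\<close> doubles the bound and adds
  \<open>m - 1\<close> to the size.\<close>

lemma T_iterate:
  assumes "r \<in> K t p" "m \<in> K t p" "T t p m \<ge> 2"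
  shows "2 ^ n \<le> T t p (r + n * (m - 1))"
proof (induction n)
  case 0
  then show ?case using assms(1) by (simp add: K_def)
next
  case (Suc n)
  have "2 ^ Suc n \<le> T t p (r + n * (m - 1)) * T t p m"
    using mult_le_mono[OF Suc.IH assms(3)] by simp
  also have "\<dots> \<le> T t p (r + n * (m - 1) + m - 1)" by (rule T_mult_le)
  also have "r + n * (m - 1) + m - 1 = r + Suc n * (m - 1)"
    using assms(2) by (simp add: K_def)
  finally show ?case .
qed

lemma K_ge_2: "k \<in> K t p \<Longrightarrow> k \<ge> 2"
  using unity_sets_card by (auto simp: mem_K_iff)

end

section \<open>Arithmetic progressions and bounds\<close>

text \<open>\<open>B\<close> collects the least element of \<open>A\<close> in each residue class
  modulo \<open>d\<close> that \<open>A\<close> meets. It serves both the progressions and the lower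
  bound.\<close>

lemma finitely_many_bases:
  fixes A :: "nat set"
  assumes "d > 0"
  obtains B where "finite B" "B \<subseteq> A" "\<And>k. k \<in> A \<Longrightarrow> \<exists>a\<in>B. \<exists>n. k = a + n * d"
proof -
  define l where "l r = (LEAST k. k \<in> A \<and> k mod d = r)" for r
  have l: "l (k mod d) \<in> A \<and> l (k mod d) mod d = k mod d" "l (k mod d) \<le> k" if "k \<in> A" for k
  proof -
    show "l (k mod d) \<in> A \<and> l (k mod d) mod d = k mod d"
      unfolding l_def by (rule LeastI[of _ k]) (simp add: that)
    show "l (k mod d) \<le> k"
      unfolding l_def by (rule Least_le) (simp add: that)
  qed
  show thesis
  proof (rule that[of "(\<lambda>k. l (k mod d)) ` A"])
    have "(\<lambda>k. l (k mod d)) ` A \<subseteq> l ` {..<d}" using assms by auto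
    then show "finite ((\<lambda>k. l (k mod d)) ` A)" by (rule finite_subset) simp
    show "(\<lambda>k. l (k mod d)) ` A \<subseteq> A" using l(1) by blast
    fix k assume k: "k \<in> A"
    have "d dvd k - l (k mod d)"
      using l(1)[OF k] l(2)[OF k] by (metis mod_eq_dvd_iff_nat)
    then obtain n where "k - l (k mod d) = d * n" by (rule dvdE)
    then have "k = l (k mod d) + n * d" using l(2)[OF k] by (simp add: mult.commute)
    then show "\<exists>a\<in>(\<lambda>k. l (k mod d)) ` A. \<exists>n. k = a + n * d" using k by blast
  qed
qed

lemma closed_under_shift_union_arith_progs:
  fixes A :: "nat set"
  assumes "d > 0" and closed: "\<And>k. k \<in> A \<Longrightarrow> k + d \<in> A"
  shows "\<exists>F. finite F \<and> (\<forall>X\<in>F. arith_prog X) \<and> int ` A = \<Union>F"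
proof -
  obtain B where B: "finite B" "B \<subseteq> A" "\<And>k. k \<in> A \<Longrightarrow> \<exists>a\<in>B. \<exists>n. k = a + n * d"
    using finitely_many_bases[OF \<open>d > 0\<close>] by blast
  define P where "P a = {int a + int d * int n | n. True}" for a
  have "arith_prog (P a)" for a
    unfolding arith_prog_def P_def using \<open>d > 0\<close>
    by (intro exI[of _ "int a"] exI[of _ "int d"] conjI refl) simp
  moreover have "int ` A = \<Union>(P ` B)"
  proof (intro equalityI subsetI)
    fix x assume "x \<in> int ` A"
    then obtain k where k: "k \<in> A" "x = int k" by blast
    then obtain a n where a: "a \<in> B" "k = a + n * d" using B(3) by blast
    then have "x = int a + int d * int n" using k(2) by simp
    with a(1) show "x \<in> \<Union>(P ` B)" unfolding P_def by blast
  next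
    fix x assume "x \<in> \<Union>(P ` B)"
    then obtain a n where a: "a \<in> B" "x = int a + int d * int n" unfolding P_def by blast
    have "a + n * d \<in> A"
    proof (induction n)
      case 0
      then show ?case using a(1) B(2) by auto
    next
      case (Suc n)
      then show ?case using closed[of "a + n * d"] by (simp add: algebra_simps)
    qed
    moreover have "x = int (a + n * d)" using a(2) by simp
    ultimately show "x \<in> int ` A" by blast
  qed
  ultimately show ?thesis using B(1) by (intro exI[of _ "P ` B"]) simp
qed

section \<open>The upper bound\<close>

text \<open>Entries are counted from 0, hence the exponent \<open>2 ^ i\<close>. With
  \<open>P\<close> the product of the earlier entries, the tail sum \<open>r\<close> lies between
  \<open>1 / P\<close> and \<open>k / (xs ! i)\<close>, so
  \<open>xs ! i \<le> k * P\<close>.\<close>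

lemma solution_nth_le:
  assumes xs: "xs \<in> solutions t p k" and "i < k"
  shows "xs ! i \<le> k ^ (2 ^ i)"
  using \<open>i < k\<close>
proof (induction i rule: less_induct)
  case (less i)
  have len: "length xs = k" and sorted: "sorted_wrt (<) xs" and gt: "\<And>j. j < k \<Longrightarrow> xs ! j > 1"
    and "(\<Sum>x\<leftarrow>xs. 1 / real x) = 1"
    using xs by (auto simp: solutions_def)
  then have sum: "(\<Sum>j<k. 1 / real (xs ! j)) = 1"
    by (simp add: sum_list_sum_nth atLeast0LessThan)
  define P where "P = (\<Prod>j<i. xs ! j)"
  define r where "r = (\<Sum>j\<in>{i..<k}. 1 / real (xs ! j))"
  have P0: "P > 0" unfolding P_def using gt less.prems by (intro prod_pos) (auto intro: less_trans)
  have "{..<k} = {..<i} \<union> {i..<k}" using less.prems by auto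
  then have "(\<Sum>j<k. 1 / real (xs ! j)) = (\<Sum>j\<in>{..<i} \<union> {i..<k}. 1 / real (xs ! j))" by metis
  also have "\<dots> = (\<Sum>j<i. 1 / real (xs ! j)) + r"
    unfolding r_def by (rule sum.union_disjoint) auto
  finally have r: "r = 1 - (\<Sum>j<i. 1 / real (xs ! j))" using sum by simp
  \<comment> \<open>Multiplication by \<open>P\<close> clears the denominators, so
    \<open>P * r\<close> is an integer.\<close>
  have "real P * (\<Sum>j<i. 1 / real (xs ! j)) = (\<Sum>j<i. real (\<Prod>l\<in>{..<i} - {j}. xs ! l))"
    unfolding sum_distrib_left
  proof (intro sum.cong refl)
    fix j assume j: "j \<in> {..<i}"
    then have "P = xs ! j * (\<Prod>l\<in>{..<i} - {j}. xs ! l)" unfolding P_def by (intro prod.remove) auto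
    moreover have "xs ! j > 1" using gt[of j] j less.prems by simp
    ultimately show "real P * (1 / real (xs ! j)) = real (\<Prod>l\<in>{..<i} - {j}. xs ! l)" by simp
  qed
  then have "real P * r = real P - real (\<Sum>j<i. \<Prod>l\<in>{..<i} - {j}. xs ! l)"
    unfolding r by (simp add: right_diff_distrib)
  then have "real P * r = real_of_int (int P - int (\<Sum>j<i. \<Prod>l\<in>{..<i} - {j}. xs ! l))"
    by simp
  then obtain z where Pr: "real P * r = real_of_int z" by blast
  have "1 / real (xs ! i) \<le> r"
    unfolding r_def using less.prems by (intro member_le_sum) auto
  moreover have "0 < 1 / real (xs ! i)" using gt[OF less.prems] by simp
  ultimately have "0 < r" by linarith
  then have "0 < real P * r" using P0 by simp
  then have "1 \<le> real P * r" unfolding Pr by simp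
  moreover have "r \<le> real k / real (xs ! i)"
  proof -
    have "1 / real (xs ! j) \<le> 1 / real (xs ! i)" if "j \<in> {i..<k}" for j
    proof (cases "j = i")
      case False
      then have "xs ! i < xs ! j" using that sorted len by (auto simp: sorted_wrt_iff_nth_less)
      then show ?thesis using gt[OF less.prems] by (intro divide_left_mono) auto
    qed simp
    then have "r \<le> (\<Sum>j\<in>{i..<k}. 1 / real (xs ! i))" unfolding r_def by (rule sum_mono)
    also have "\<dots> \<le> real k / real (xs ! i)" by (simp add: divide_right_mono)
    finally show ?thesis .
  qed
  then have "real P * r \<le> real P * (real k / real (xs ! i))" by (rule mult_left_mono) simp
  ultimately have "1 \<le> real P * real k / real (xs ! i)" by simp
  then have "real (xs ! i) \<le> real (k * P)" using gt[OF less.prems] by (simp add: field_simps)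
  then have "xs ! i \<le> k * P" by (simp only: of_nat_le_iff)
  also have "\<dots> \<le> k * (\<Prod>j<i. k ^ (2 ^ j))"
    unfolding P_def using less by (intro mult_le_mono2 prod_mono) auto
  \<comment> \<open>The exponents add up to
    \<open>1 + (1 + 2 + ... + 2 ^ (n - 1)) = 2 ^ n\<close>.\<close>
  also have "k * (\<Prod>j<n. k ^ (2 ^ j)) = k ^ (2 ^ n)" for n
    by (induction n) (simp_all add: mult.assoc[symmetric] mult_2 power_add)
  finally show ?case .
qed

text \<open>Primes are at least 2, so each exponent of an element up to \<open>2 ^ l\<close> is at
  most \<open>l\<close>; this leaves \<open>l + 1\<close> choices for each of the \<open>t\<close>
  exponents.\<close>

lemma card_S_le:
  assumes "\<forall>i\<in>{1..t}. prime (p i)"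
  shows "finite (S t p \<inter> {..2 ^ l})" "card (S t p \<inter> {..2 ^ l}) \<le> (l + 1) ^ t"
proof -
  show "finite (S t p \<inter> {..2 ^ l})" by simp
  define f where "f a = (\<Prod>i=1..t. p i ^ a i)" for a
  define E where "E = (\<Pi>\<^sub>E i\<in>{1..t}. {..l})"
  have "S t p \<inter> {..2 ^ l} \<subseteq> f ` E"
  proof
    fix x assume x: "x \<in> S t p \<inter> {..2 ^ l}"
    then obtain a where a: "x = f a" by (auto simp: S_def f_def)
    have "a i \<le> l" if i: "i \<in> {1..t}" for i
    proof -
      have "p i \<ge> 2" using assms i prime_ge_2_nat by blast
      then have "2 ^ a i \<le> p i ^ a i" by (rule power_mono) simp
      also have "p i ^ a i dvd x" unfolding a f_def using i by (intro dvd_prodI) auto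
      then have "p i ^ a i \<le> x" using x mem_S_iff[OF assms, of x] by (intro dvd_imp_le) auto
      also have "x \<le> 2 ^ l" using x by simp
      finally show ?thesis by simp
    qed
    then have "restrict a {1..t} \<in> E" by (auto simp: E_def)
    moreover have "x = f (restrict a {1..t})" unfolding a f_def by (intro prod.cong) auto
    ultimately show "x \<in> f ` E" by blast
  qed
  then have "card (S t p \<inter> {..2 ^ l}) \<le> card (f ` E)"
    by (intro card_mono finite_imageI) (auto simp: E_def finite_PiE)
  also have "\<dots> \<le> card E" by (intro card_image_le) (auto simp: E_def finite_PiE)
  also have "\<dots> = (l + 1) ^ t" by (simp add: E_def card_PiE)
  finally show "card (S t p \<inter> {..2 ^ l}) \<le> (l + 1) ^ t" .
qed

text \<open>By \<open>k \<le> 2 ^ k\<close> the entry at index \<open>i\<close> is at most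
  \<open>2 ^ (k * 2 ^ i)\<close>. Rounding its \<open>k * 2 ^ i + 1\<close> exponent choices per
  prime up to \<open>k * 2 ^ (i + 1)\<close> gives a product with a closed form.\<close>

lemma T_le_prod:
  assumes "\<forall>i\<in>{1..t}. prime (p i)" "k > 0"
  shows "T t p k \<le> (\<Prod>i<k. k * 2 ^ (i + 1)) ^ t"
proof -
  define B where "B i = S t p \<inter> {..2 ^ (k * 2 ^ i)}" for i
  have "T t p k \<le> card (\<Pi>\<^sub>E i\<in>{..<k}. B i)"
    unfolding T_def
  proof (rule card_inj_on_le[of "\<lambda>xs. restrict ((!) xs) {..<k}"])
    show "inj_on (\<lambda>xs. restrict ((!) xs) {..<k}) (solutions t p k)"
    proof (rule inj_onI)
      fix xs ys assume xy: "xs \<in> solutions t p k" "ys \<in> solutions t p k"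
        "restrict ((!) xs) {..<k} = restrict ((!) ys) {..<k}"
      have "xs ! i = ys ! i" if "i < k" for i
        using fun_cong[OF xy(3), of i] that by simp
      then show "xs = ys" using xy(1,2) by (intro nth_equalityI) (auto simp: solutions_def)
    qed
    have "xs ! i \<in> B i" if xs: "xs \<in> solutions t p k" and i: "i < k" for xs i
    proof -
      have "xs ! i \<le> k ^ (2 ^ i)" using solution_nth_le[OF xs i] .
      also have "\<dots> \<le> (2 ^ k) ^ (2 ^ i)" using less_exp[of k] by (intro power_mono) auto
      finally have "xs ! i \<le> 2 ^ (k * 2 ^ i)" by (simp add: power_mult)
      moreover have "xs ! i \<in> S t p" using xs i by (auto simp: solutions_def)
      ultimately show ?thesis by (simp add: B_def)
    qed
    then show "(\<lambda>xs. restrict ((!) xs) {..<k}) ` solutions t p k \<subseteq> (\<Pi>\<^sub>E i\<in>{..<k}. B i)"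
      by (intro image_subsetI) (simp add: restrict_PiE_iff)
    show "finite (\<Pi>\<^sub>E i\<in>{..<k}. B i)" by (intro finite_PiE) (auto simp: B_def)
  qed
  also have "\<dots> = (\<Prod>i<k. card (B i))" by (simp add: card_PiE)
  also have "\<dots> \<le> (\<Prod>i<k. (k * 2 ^ (i + 1)) ^ t)"
  proof (intro prod_mono conjI)
    fix i
    have "card (B i) \<le> (k * 2 ^ i + 1) ^ t" unfolding B_def by (rule card_S_le(2)[OF assms(1)])
    also have "\<dots> \<le> (k * 2 ^ (i + 1)) ^ t"
    proof (rule power_mono)
      have "1 \<le> k * 2 ^ i" using \<open>k > 0\<close> by (simp add: Suc_leI)
      then show "k * 2 ^ i + 1 \<le> k * 2 ^ (i + 1)" by simp
    qed simp
    finally show "card (B i) \<le> (k * 2 ^ (i + 1)) ^ t" .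
  qed simp
  also have "\<dots> = (\<Prod>i<k. k * 2 ^ (i + 1)) ^ t" by (rule prod_power_distrib[symmetric])
  finally show ?thesis .
qed

lemma prod_geometric_eq_powr:
  assumes "c > (0 :: real)"
  shows "(\<Prod>i<n. c * 2 ^ (i + 1)) = 2 powr (real n * log 2 c + real n * (real n + 1) / 2)"
proof (induction n)
  case (Suc n)
  have "(\<Prod>i<Suc n. c * 2 ^ (i + 1)) = 2 powr (real n * log 2 c + real n * (real n + 1) / 2) * (c * 2 ^ (n + 1))"
    using Suc by simp
  also have "c * 2 ^ (n + 1) = 2 powr (log 2 c + real (n + 1))"
    using assms by (simp add: powr_add powr_realpow)
  also have "2 powr (real n * log 2 c + real n * (real n + 1) / 2) * 2 powr (log 2 c + real (n + 1))
      = 2 powr (real (Suc n) * log 2 c + real (Suc n) * (real (Suc n) + 1) / 2)"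
    unfolding powr_add[symmetric] by (rule arg_cong[of _ _ "(powr) 2"]) (simp add: field_simps)
  finally show ?case .
qed simp

text \<open>Passing from base 2 to base \<open>sqrt 2\<close> doubles the exponent, and
  \<open>2 * k * log 2 k + k * (k + 1)\<close> is \<open>k ^ 2\<close> times the factor
  stated.\<close>

lemma T_le_powr:
  assumes "\<forall>i\<in>{1..t}. prime (p i)" "k > 0"
  shows "real (T t p k) \<le> sqrt 2 powr (real t * (real k)\<^sup>2 * (1 + (1 / real k + 2 * log 2 (real k) / real k)))"
proof -
  have "real (T t p k) \<le> real ((\<Prod>i<k. k * 2 ^ (i + 1)) ^ t)"
    using T_le_prod[OF assms] by (simp only: of_nat_le_iff)
  also have "\<dots> = (\<Prod>i<k. real k * 2 ^ (i + 1)) ^ t" by simp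
  also have "(\<Prod>i<k. real k * 2 ^ (i + 1)) = 2 powr (real k * log 2 (real k) + real k * (real k + 1) / 2)"
    using assms(2) by (intro prod_geometric_eq_powr) simp
  also have "\<dots> ^ t = 2 powr ((real k * log 2 (real k) + real k * (real k + 1) / 2) * real t)"
    by (simp add: powr_powr flip: powr_realpow)
  also have "\<dots> = (2 powr (1 / 2)) powr (real t * (real k)\<^sup>2 * (1 + (1 / real k + 2 * log 2 (real k) / real k)))"
    unfolding powr_powr using assms(2)
    by (intro arg_cong[of _ _ "(powr) 2"]) (simp add: field_simps power2_eq_square)
  also have "(2 :: real) powr (1 / 2) = sqrt 2" by (simp add: powr_half_sqrt)
  finally show ?thesis .
qed

lemma error_term_tendsto_0: "(\<lambda>k. 1 / real k + 2 * log 2 (real k) / real k) \<longlonglongrightarrow> 0"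
proof -
  have "(\<lambda>k. 1 / real k + 2 / ln 2 * (ln (real k) / real k)) \<longlonglongrightarrow> 0 + 2 / ln 2 * 0"
    by (intro tendsto_add tendsto_mult tendsto_const lim_1_over_n
        filterlim_compose[OF ln_x_over_x_tendsto_0 filterlim_real_sequentially])
  then show ?thesis by (simp add: log_def)
qed

section \<open>The lower bound and the conclusion\<close>

lemma T_exponential_lower_bound:
  assumes primes: "\<forall>i\<in>{1..t}. prime (p i)"
  shows "\<exists>(k0 :: nat) c. 1 < c \<and> (\<forall>k\<in>K t p. k0 < k \<longrightarrow> c ^ k \<le> real (T t p k))"
proof (cases "K t p = {}")
  case True
  then show ?thesis by (auto intro!: exI[of _ 2])
next
  case False
  then obtain m where m: "m \<in> K t p" "T t p m \<ge> 2" using ex_T_ge_2[OF primes] by blast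
  define d where "d = m - 1"
  have d: "d > 0" using K_ge_2[OF primes m(1)] by (simp add: d_def)
  obtain B where B: "finite B" "B \<subseteq> K t p" "\<And>k. k \<in> K t p \<Longrightarrow> \<exists>a\<in>B. \<exists>n. k = a + n * d"
    using finitely_many_bases[OF d] by blast
  obtain R where R: "\<And>a. a \<in> B \<Longrightarrow> a < R"
    using B(1) unfolding finite_nat_set_iff_bounded by blast
  \<comment> \<open>For \<open>k = a + n * d\<close> with \<open>a < R\<close> and
    \<open>2 * R < k\<close>, the \<open>n\<close> steps of length \<open>d\<close> make up at least
    half of \<open>k\<close>, so \<open>n \<ge> k / (2 * d)\<close> and
    \<open>2 ^ n \<ge> c ^ k\<close>.\<close>
  define c :: real where "c = 2 powr (1 / (2 * real d))"
  have "c ^ k \<le> real (T t p k)" if k: "k \<in> K t p" "2 * R < k" for k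
  proof -
    obtain a n where a: "a \<in> B" "k = a + n * d" using B(3)[OF k(1)] by blast
    have "k \<le> 2 * (n * d)" using R[OF a(1)] k(2) a(2) by linarith
    then have "real k \<le> real (2 * (n * d))" by (simp only: of_nat_le_iff)
    then have "real k / (2 * real d) \<le> real n" using d by (simp add: field_simps)
    have "c ^ k = 2 powr (real k / (2 * real d))"
      by (simp add: c_def powr_powr flip: powr_realpow)
    also have "\<dots> \<le> 2 powr real n" using \<open>real k / (2 * real d) \<le> real n\<close> by simp
    also have "\<dots> = real (2 ^ n)" by (simp add: powr_realpow)
    also have "\<dots> \<le> real (T t p k)"
      using T_iterate[OF primes _ m, of a n] a B(2) unfolding d_def of_nat_le_iff by blast
    finally show ?thesis .
  qed
  moreover have "c > 1" using d by (simp add: c_def)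
  ultimately show ?thesis by blast
qed

theorem theorem2:
  fixes t :: nat and p :: "nat \<Rightarrow> nat"
  assumes "1 \<le> t"
    and "\<forall>i\<in>{1..t}. prime (p i)"
    and "inj_on p {1..t}"
  shows "(\<exists>F. finite F \<and> (\<forall>A\<in>F. arith_prog A) \<and> int ` K t p = \<Union>F) \<and>
    (\<exists>(k0 :: nat) (c1 :: real) (e :: nat \<Rightarrow> real).
        1 < c1 \<and> e \<longlonglongrightarrow> 0 \<and>
        (\<forall>k\<in>K t p. k0 < k \<longrightarrow>
           c1 ^ k \<le> real (T t p k) \<and>
           real (T t p k) \<le> sqrt 2 powr (real t * (real k)\<^sup>2 * (1 + e k))))"
proof
  show "\<exists>F. finite F \<and> (\<forall>A\<in>F. arith_prog A) \<and> int ` K t p = \<Union>F"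
  proof (cases "K t p = {}")
    case True
    then show ?thesis by (intro exI[of _ "{}"]) simp
  next
    case False
    then obtain m where m: "m \<in> K t p" by blast
    then have "m - 1 > 0" using K_ge_2[OF assms(2)] by fastforce
    then show ?thesis
      using K_closed[OF assms(2) _ m] by (rule closed_under_shift_union_arith_progs)
  qed
  obtain k0 c where c: "c > 1" "\<And>k. k \<in> K t p \<Longrightarrow> k0 < k \<Longrightarrow> c ^ k \<le> real (T t p k)"
    using T_exponential_lower_bound[OF assms(2)] by blast
  \<comment> \<open>An explicit error term; with it the upper bound holds for every \<open>k\<close>
    in \<open>K t p\<close>, so \<open>k0\<close> comes from the lower bound.\<close>
  define e where "e k = 1 / real k + 2 * log 2 (real k) / real k" for k
  have "e \<longlonglongrightarrow> 0" unfolding e_def by (rule error_term_tendsto_0)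
  moreover have "real (T t p k) \<le> sqrt 2 powr (real t * (real k)\<^sup>2 * (1 + e k))" if "k \<in> K t p" for k
    unfolding e_def using T_le_powr[OF assms(2)] K_ge_2[OF assms(2) that] by simp
  ultimately show "\<exists>(k0 :: nat) (c1 :: real) (e :: nat \<Rightarrow> real).
        1 < c1 \<and> e \<longlonglongrightarrow> 0 \<and>
        (\<forall>k\<in>K t p. k0 < k \<longrightarrow>
           c1 ^ k \<le> real (T t p k) \<and>
           real (T t p k) \<le> sqrt 2 powr (real t * (real k)\<^sup>2 * (1 + e k)))"
    using c by blast
qed

end
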